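(* Let $A_1,\ldots,A_m$ be $n\times n$ positive definite matrices and let $\alpha_1,\ldots,\alpha_m\ge 0$ be such that $\sum_{i=1}^m\alpha_i=1$. For real $p\ne 0$ let $F(p)=\left(\alpha_1A_1^p+\cdots+\alpha_mA_m^p\right)^{1/p}$, and let $F(0)=\lim_{p\to0}F(p)=e^{\alpha_1\log A_1+\cdots+\alpha_m\log A_m}$. Then for each $1\le j\le n$ the function $p\mapsto\lambda_j(F(p))$ is increasing on $(-\infty,\infty)$. In particular, when $\alpha_1=\cdots=\alpha_m=1/m$, so that $F(p)=\left(\frac{A_1^p+\cdots+A_m^p}{m}\right)^{1/p}$ for $p\neq 0$, each $\lambda_j(F(p))$ is an increasing function of $p$ on $(-\infty,\infty)$, and therefore for every unitarily invariant norm $|||\cdot|||$ on the space of $n\times n$ matrices $|||F(p)|||$ is an increasing function of $p$ on $(-\infty,\infty)$.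
   Context: Matrices are $n\times n$ (complex), and positive definite matrices are Hermitian. Real powers and logarithms of positive definite matrices are defined by the usual functional calculus. For a Hermitian matrix $X$, $\lambda_1(X)\ge\cdots\ge\lambda_n(X)$ denote its eigenvalues in decreasing order, counted with multiplicity. A norm $|||\cdot|||$ on $n\times n$ matrices is unitarily invariant if $|||UXV|||=|||X|||$ for all matrices $X$ and all unitary $U,V$. "Increasing" means nondecreasing. It is a known fact (Bhagwat and Subramanian) that $\lim_{p\to0}\left(\alpha_1A_1^p+\cdots+\alpha_mA_m^p\right)^{1/p}=e^{\alpha_1\log A_1+\cdots+\alpha_m\log A_m}$. *)

theory Defs
  imports "HOL-Analysis.Analysis" "HOL-Computational_Algebra.Computational_Algebra"
begin

definition cadjoint :: "complex^'n^'n \<Rightarrow> complex^'n^'n" where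
  "cadjoint A = (\<chi> i j. cnj (A $ j $ i))"

definition hermitian_mat :: "complex^'n^'n \<Rightarrow> bool" where
  "hermitian_mat A \<longleftrightarrow> cadjoint A = A"

definition unitary_mat :: "complex^'n^'n \<Rightarrow> bool" where
  "unitary_mat U \<longleftrightarrow> cadjoint U ** U = mat 1 \<and> U ** cadjoint U = mat 1"

(* The quadratic form of a Hermitian matrix is real-valued, so Re loses nothing. *)
definition posdef_mat :: "complex^'n^'n \<Rightarrow> bool" where
  "posdef_mat A \<longleftrightarrow> hermitian_mat A \<and>
     (\<forall>x. x \<noteq> 0 \<longrightarrow> 0 < Re (\<Sum>i\<in>UNIV. cnj (x $ i) * (A *v x) $ i))"

definition real_diag :: "('n \<Rightarrow> real) \<Rightarrow> complex^'n^'n" where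
  "real_diag d = (\<chi> i j. if i = j then complex_of_real (d i) else 0)"

(* Functional calculus of a Hermitian matrix through a unitary diagonalization;
   fun_calculus_eqI below: the value does not depend on the diagonalization.
   Meaningless if A is not Hermitian. *)
definition fun_calculus :: "(real \<Rightarrow> real) \<Rightarrow> complex^'n^'n \<Rightarrow> complex^'n^'n" where
  "fun_calculus f A = (THE B. \<exists>U d. unitary_mat U \<and>
      A = U ** real_diag d ** cadjoint U \<and> B = U ** real_diag (\<lambda>i. f (d i)) ** cadjoint U)"

definition mat_powr :: "complex^'n^'n \<Rightarrow> real \<Rightarrow> complex^'n^'n" where
  "mat_powr A p = fun_calculus (\<lambda>x. x powr p) A"

definition mat_ln :: "complex^'n^'n \<Rightarrow> complex^'n^'n" where
  "mat_ln A = fun_calculus ln A"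

definition mat_exp :: "complex^'n^'n \<Rightarrow> complex^'n^'n" where
  "mat_exp A = fun_calculus exp A"

definition charpoly :: "complex^'n^'n \<Rightarrow> complex poly" where
  "charpoly A = det (mat [:0, 1:] - map_matrix (\<lambda>a. [:a:]) A)"

(* The j-th largest eigenvalue, 1 \<le> j \<le> CARD('n), with multiplicity, of a Hermitian
   matrix; all its eigenvalues are real, so Re only changes the type. *)
definition eigval :: "nat \<Rightarrow> complex^'n^'n \<Rightarrow> real" where
  "eigval j X = rev (sorted_list_of_multiset (image_mset Re (proots (charpoly X)))) ! (j - 1)"

definition matrix_norm :: "(complex^'n^'n \<Rightarrow> real) \<Rightarrow> bool" where
  "matrix_norm N \<longleftrightarrow>
     (\<forall>X. 0 \<le> N X) \<and> (\<forall>X. N X = 0 \<longleftrightarrow> X = 0) \<and>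
     (\<forall>c X. N (map_matrix ((*) c) X) = cmod c * N X) \<and>
     (\<forall>X Y. N (X + Y) \<le> N X + N Y)"

definition unitarily_invariant_norm :: "(complex^'n^'n \<Rightarrow> real) \<Rightarrow> bool" where
  "unitarily_invariant_norm N \<longleftrightarrow> matrix_norm N \<and>
     (\<forall>X U V. unitary_mat U \<longrightarrow> unitary_mat V \<longrightarrow> N (U ** X ** V) = N X)"

definition power_mean ::
    "nat \<Rightarrow> (nat \<Rightarrow> real) \<Rightarrow> (nat \<Rightarrow> complex^'n^'n) \<Rightarrow> real \<Rightarrow> complex^'n^'n" where
  "power_mean m \<alpha> A p =
     (if p = 0 then mat_exp (\<Sum>i=1..m. \<alpha> i *\<^sub>R mat_ln (A i))
      else mat_powr (\<Sum>i=1..m. \<alpha> i *\<^sub>R mat_powr (A i) p) (1 / p))"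

lemma real_diag_mult_left: "(real_diag d ** M) $ i $ j = complex_of_real (d i) * M $ i $ j"
  by (simp add: real_diag_def matrix_matrix_mult_def if_distrib[of "\<lambda>x. x * _"] cong: if_cong)

lemma real_diag_mult_right: "(M ** real_diag d) $ i $ j = M $ i $ j * complex_of_real (d j)"
  by (simp add: real_diag_def matrix_matrix_mult_def if_distrib[of "\<lambda>x. _ * x"] cong: if_cong)

lemma fun_calculus_eqI:
  assumes U: "unitary_mat U" and A: "A = U ** real_diag d ** cadjoint U"
  shows "fun_calculus f A = U ** real_diag (\<lambda>i. f (d i)) ** cadjoint U"
  unfolding fun_calculus_def
proof (rule the_equality)
  show "\<exists>V e. unitary_mat V \<and> A = V ** real_diag e ** cadjoint V \<and>
      U ** real_diag (\<lambda>i. f (d i)) ** cadjoint U = V ** real_diag (\<lambda>i. f (e i)) ** cadjoint V"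
    using U A by blast
next
  fix B
  assume "\<exists>V e. unitary_mat V \<and> A = V ** real_diag e ** cadjoint V \<and>
      B = V ** real_diag (\<lambda>i. f (e i)) ** cadjoint V"
  then obtain V e where V: "unitary_mat V" and AV: "A = V ** real_diag e ** cadjoint V"
    and B: "B = V ** real_diag (\<lambda>i. f (e i)) ** cadjoint V" by blast
  define W where "W = cadjoint V ** U"
  have "V ** real_diag e ** cadjoint V = U ** real_diag d ** cadjoint U"
    using A AV by simp
  then have "cadjoint V ** (V ** real_diag e ** cadjoint V) ** U
      = cadjoint V ** (U ** real_diag d ** cadjoint U) ** U" by simp
  moreover have "cadjoint V ** (V ** real_diag e ** cadjoint V) ** U
      = (cadjoint V ** V) ** real_diag e ** W"
    by (simp add: W_def matrix_mul_assoc)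
  moreover have "cadjoint V ** (U ** real_diag d ** cadjoint U) ** U
      = W ** real_diag d ** (cadjoint U ** U)"
    by (simp add: W_def matrix_mul_assoc)
  ultimately have eq: "real_diag e ** W = W ** real_diag d"
    using U V by (simp add: unitary_mat_def)
  have "real_diag (\<lambda>i. f (e i)) ** W = W ** real_diag (\<lambda>i. f (d i))"
  proof -
    have "complex_of_real (f (e i)) * W $ i $ j = W $ i $ j * complex_of_real (f (d j))" for i j
    proof (cases "W $ i $ j = 0")
      case False
      have "complex_of_real (e i) * W $ i $ j = W $ i $ j * complex_of_real (d j)"
        using arg_cong[OF eq, of "\<lambda>M. M $ i $ j"]
        by (simp add: real_diag_mult_left real_diag_mult_right)
      then have "e i = d j" using False by simp
      then show ?thesis by simp
    qed simp
    then show ?thesis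
      by (simp add: vec_eq_iff real_diag_mult_left real_diag_mult_right)
  qed
  then have "V ** (real_diag (\<lambda>i. f (e i)) ** W) ** cadjoint U
      = V ** (W ** real_diag (\<lambda>i. f (d i))) ** cadjoint U" by simp
  moreover have "V ** (real_diag (\<lambda>i. f (e i)) ** W) ** cadjoint U
      = V ** real_diag (\<lambda>i. f (e i)) ** cadjoint V ** (U ** cadjoint U)"
    by (simp add: W_def matrix_mul_assoc)
  moreover have "V ** (W ** real_diag (\<lambda>i. f (d i))) ** cadjoint U
      = (V ** cadjoint V) ** U ** real_diag (\<lambda>i. f (d i)) ** cadjoint U"
    by (simp add: W_def matrix_mul_assoc)
  ultimately show "B = U ** real_diag (\<lambda>i. f (d i)) ** cadjoint U"
    using U V B by (simp add: unitary_mat_def)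
qed

end

(* The quadratic form of S(p) = sum_i \<alpha>_i A_i^p (of sum_i \<alpha>_i log A_i, if p = 0) at a unit
   vector x is sum_k w_k a_k^p (sum_k w_k log a_k), where the a_k are the eigenvalues of all the A_i
   and the weights w_k, of total 1, depend on x but not on p.  If d_1, ..., d_n are the eigenvalues
   of F(p), the same quadratic form is sum_k c_k d_k^p, with c_k the squared moduli of the coordinates
   of x in an eigenbasis.  So the scalar power mean of order p of the d_k with weights c_k equals that
   of the a_k with weights w_k, and the latter increases with p.  For p <= q a dimension count gives a
   unit x in the span of the eigenvectors of the j largest eigenvalues of F(p) and in that of the
   n - j + 1 smallest ones of F(q); then lambda_j(F(p)) <= M_p(x) <= M_q(x) <= lambda_j(F(q)).
   No operator convexity is needed.

   A unitarily invariant norm of a positive definite matrix is the norm of the diagonal of its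
   eigenvalues, hence monotone in them: diag(s, ...) with 0 <= s <= t is a convex combination of
   diag(t, ...) and diag(-t, ...), which have the same norm.

   For the limit, let p_n -> 0 and let U_n diagonalize S(p_n).  Along a subsequence U_n -> V, so the
   eigenvalues of (S(p_n) - 1) / p_n -> S(0) converge, and (1 + p_n h_n)^(1 / p_n) -> e^c whenever
   h_n -> c. *)
theory Submission
  imports Defs
begin

section \<open>Weighted power means of positive reals\<close>

text \<open>Generator of the power mean of order \<open>p\<close> as a quasi-arithmetic mean. The
  value \<open>ln\<close> at \<open>p = 0\<close> gives the geometric mean, and lets one set of
  formulas cover \<open>F(0)\<close> and the other orders.\<close>

definition mean_gen :: "real \<Rightarrow> real \<Rightarrow> real" where
  "mean_gen p x = (if p = 0 then ln x else x powr p)"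

text \<open>Inverts \<open>mean_gen p\<close> on positive arguments if \<open>p \<noteq> 0\<close>
  and on all reals if \<open>p = 0\<close>; hence the recurring side condition
  \<open>p = 0 \<or> 0 < y\<close>.\<close>

definition mean_gen_inv :: "real \<Rightarrow> real \<Rightarrow> real" where
  "mean_gen_inv p y = (if p = 0 then exp y else y powr (1 / p))"

definition scalar_mean :: "'k set \<Rightarrow> ('k \<Rightarrow> real) \<Rightarrow> ('k \<Rightarrow> real) \<Rightarrow> real \<Rightarrow> real" where
  "scalar_mean K w a p = mean_gen_inv p (\<Sum>k\<in>K. w k * mean_gen p (a k))"

locale weighted =
  fixes K :: "'k set" and w :: "'k \<Rightarrow> real"
  assumes finite_K: "finite K" and w_nonneg: "\<And>k. k \<in> K \<Longrightarrow> 0 \<le> w k" and sum_w: "sum w K = 1"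
begin

lemma sum_pos:
  assumes "\<And>k. k \<in> K \<Longrightarrow> 0 < f k"
  shows "0 < (\<Sum>k\<in>K. w k * f k)"
proof -
  obtain k where "k \<in> K" "w k \<noteq> 0"
    using sum_w by (metis sum.neutral zero_neq_one)
  then have "0 < w k * f k" using w_nonneg[of k] assms[of k] by simp
  then show ?thesis
    using \<open>k \<in> K\<close> finite_K w_nonneg assms by (intro sum_pos2[where i = k]) (auto simp: less_imp_le)
qed

lemma K_nonempty: "K \<noteq> {}"
  using sum_w by auto

lemma jensen:
  assumes "convex_on S f" "\<And>k. k \<in> K \<Longrightarrow> y k \<in> S"
  shows "f (\<Sum>k\<in>K. w k * y k) \<le> (\<Sum>k\<in>K. w k * f (y k))"
  using convex_on_sum[OF finite_K K_nonempty assms(1) sum_w w_nonneg, of y] assms(2) by simp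

lemma scalar_mean_pos:
  assumes "\<And>k. k \<in> K \<Longrightarrow> 0 < a k"
  shows "0 < scalar_mean K w a p"
  using sum_pos[of "\<lambda>k. a k powr p"] assms
  by (fastforce simp: scalar_mean_def mean_gen_inv_def mean_gen_def)

text \<open>Since \<open>(1 / a) powr (- p) = a powr p\<close>, both sides contain the same sum and
  only the outer exponent changes sign. Facts about nonnegative orders are carried to negative ones
  this way.\<close>

lemma scalar_mean_inverse:
  assumes a: "\<And>k. k \<in> K \<Longrightarrow> 0 < a k"
  shows "scalar_mean K w a p = inverse (scalar_mean K w (\<lambda>k. inverse (a k)) (- p))"
proof (cases "p = 0")
  case True
  then show ?thesis
    using a by (simp add: scalar_mean_def mean_gen_def mean_gen_inv_def ln_inverse sum_negf exp_minus)
next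
  case False
  have "(\<Sum>k\<in>K. w k * inverse (a k) powr - p) = (\<Sum>k\<in>K. w k * a k powr p)"
    using a by (intro sum.cong) (auto simp: powr_minus inverse_powr less_imp_le)
  then show ?thesis
    using False by (simp add: scalar_mean_def mean_gen_def mean_gen_inv_def powr_minus)
qed

text \<open>Jensen's inequality followed by a \<open>q\<close>-th root: for \<open>exp\<close> at
  the points \<open>q * ln (a k)\<close> if \<open>p = 0\<close>, and for the convex power
  \<open>q / p > 1\<close> at the points \<open>a k powr p\<close> if
  \<open>0 < p < q\<close>.\<close>

lemma scalar_mean_mono_nonneg:
  assumes a: "\<And>k. k \<in> K \<Longrightarrow> 0 < a k" and "0 \<le> p" "p \<le> q"
  shows "scalar_mean K w a p \<le> scalar_mean K w a q"
proof -
  consider "p = q" | "p = 0" "0 < q" | "0 < p" "p < q" using assms by linarith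
  then show ?thesis
  proof cases
    case 2
    have "exp (\<Sum>k\<in>K. w k * (q * ln (a k))) \<le> (\<Sum>k\<in>K. w k * exp (q * ln (a k)))"
      by (rule jensen[OF exp_convex]) simp
    also have "\<dots> = (\<Sum>k\<in>K. w k * a k powr q)"
      using a by (intro sum.cong refl) (fastforce simp: powr_def)
    finally have "exp (q * (\<Sum>k\<in>K. w k * ln (a k))) \<le> (\<Sum>k\<in>K. w k * a k powr q)"
      by (simp add: sum_distrib_left mult.left_commute)
    then have "exp (q * (\<Sum>k\<in>K. w k * ln (a k))) powr (1 / q) \<le> (\<Sum>k\<in>K. w k * a k powr q) powr (1 / q)"
      using 2 by (intro powr_mono2) auto
    then show ?thesis
      using 2 by (simp add: scalar_mean_def mean_gen_def mean_gen_inv_def exp_powr_real)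
  next
    case 3
    let ?S = "\<Sum>k\<in>K. w k * a k powr p"
    have S: "0 < ?S" using a by (intro sum_pos) (fastforce simp: order_less_imp_not_eq2)
    have "?S powr (q / p) \<le> (\<Sum>k\<in>K. w k * (a k powr p) powr (q / p))"
      using 3 a by (intro jensen[OF powr_convex]) (fastforce simp: order_less_imp_not_eq2)+
    also have "\<dots> = (\<Sum>k\<in>K. w k * a k powr q)"
      using 3 by (simp add: powr_powr)
    finally have "(?S powr (q / p)) powr (1 / q) \<le> (\<Sum>k\<in>K. w k * a k powr q) powr (1 / q)"
      using 3 by (intro powr_mono2) auto
    then show ?thesis
      using 3 by (simp add: scalar_mean_def mean_gen_def mean_gen_inv_def powr_powr)
  qed simp
qed

text \<open>Inverting the values reverses the inequality twice, which settles nonpositive orders;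
  orders of opposite sign are compared through order 0.\<close>

lemma scalar_mean_mono:
  assumes a: "\<And>k. k \<in> K \<Longrightarrow> 0 < a k" and "p \<le> q"
  shows "scalar_mean K w a p \<le> scalar_mean K w a q"
proof -
  have neg: "scalar_mean K w a p \<le> scalar_mean K w a q" if "p \<le> q" "q \<le> 0" for p q
  proof -
    have "scalar_mean K w (\<lambda>k. inverse (a k)) (- q) \<le> scalar_mean K w (\<lambda>k. inverse (a k)) (- p)"
      using a that by (intro scalar_mean_mono_nonneg) auto
    moreover have "0 < scalar_mean K w (\<lambda>k. inverse (a k)) (- q)"
      using a by (intro scalar_mean_pos) auto
    ultimately show ?thesis
      using a by (simp add: scalar_mean_inverse[of a] le_imp_inverse_le)
  qed
  show ?thesis
  proof (cases "0 \<le> p \<or> q \<le> 0")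
    case True
    then show ?thesis using scalar_mean_mono_nonneg[of a p q] neg[of p q] a assms(2) by auto
  next
    case False
    then show ?thesis using scalar_mean_mono_nonneg[of a 0 q] neg[of p 0] a by fastforce
  qed
qed

text \<open>For \<open>p \<ge> 0\<close> the generator preserves order. The bound is asked for only
  where the weight is nonzero: later these are the coordinates of a vector confined to a span of
  eigenvectors.\<close>

lemma scalar_mean_ge_nonneg:
  assumes a: "\<And>k. k \<in> K \<Longrightarrow> 0 < a k" and t: "0 < t" "\<And>k. k \<in> K \<Longrightarrow> w k \<noteq> 0 \<Longrightarrow> t \<le> a k"
    and "0 \<le> p"
  shows "t \<le> scalar_mean K w a p"
proof -
  have "(\<Sum>k\<in>K. w k * mean_gen p t) \<le> (\<Sum>k\<in>K. w k * mean_gen p (a k))"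
  proof (rule sum_mono)
    fix k assume k: "k \<in> K"
    show "w k * mean_gen p t \<le> w k * mean_gen p (a k)"
    proof (cases "w k = 0")
      case False
      then have "mean_gen p t \<le> mean_gen p (a k)"
        using t k a[OF k] \<open>0 \<le> p\<close> by (auto simp: mean_gen_def intro!: powr_mono2)
      then show ?thesis using w_nonneg[OF k] by (rule mult_left_mono)
    qed simp
  qed
  then have le: "mean_gen p t \<le> (\<Sum>k\<in>K. w k * mean_gen p (a k))"
    by (simp add: sum_distrib_right[symmetric] sum_w)
  show ?thesis
  proof (cases "p = 0")
    case True
    then show ?thesis using le t(1)
      by (simp add: scalar_mean_def mean_gen_def mean_gen_inv_def flip: ln_ge_iff) (metis exp_le_cancel_iff exp_ln)
  next
    case False
    then have "(t powr p) powr (1 / p) \<le> (\<Sum>k\<in>K. w k * a k powr p) powr (1 / p)"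
      using le \<open>0 \<le> p\<close> by (intro powr_mono2) (auto simp: mean_gen_def)
    then show ?thesis using False t(1)
      by (simp add: scalar_mean_def mean_gen_def mean_gen_inv_def powr_powr)
  qed
qed

lemma scalar_mean_le_nonneg:
  assumes a: "\<And>k. k \<in> K \<Longrightarrow> 0 < a k" and t: "0 < t" "\<And>k. k \<in> K \<Longrightarrow> w k \<noteq> 0 \<Longrightarrow> a k \<le> t"
    and "0 \<le> p"
  shows "scalar_mean K w a p \<le> t"
proof -
  have "(\<Sum>k\<in>K. w k * mean_gen p (a k)) \<le> (\<Sum>k\<in>K. w k * mean_gen p t)"
  proof (rule sum_mono)
    fix k assume k: "k \<in> K"
    show "w k * mean_gen p (a k) \<le> w k * mean_gen p t"
    proof (cases "w k = 0")
      case False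
      then have "mean_gen p (a k) \<le> mean_gen p t"
        using t k a[OF k] \<open>0 \<le> p\<close> by (auto simp: mean_gen_def intro!: powr_mono2)
      then show ?thesis using w_nonneg[OF k] by (rule mult_left_mono)
    qed simp
  qed
  then have le: "(\<Sum>k\<in>K. w k * mean_gen p (a k)) \<le> mean_gen p t"
    by (simp add: sum_distrib_right[symmetric] sum_w)
  show ?thesis
  proof (cases "p = 0")
    case True
    then show ?thesis using le t(1)
      by (simp add: scalar_mean_def mean_gen_def mean_gen_inv_def) (metis exp_le_cancel_iff exp_ln)
  next
    case False
    then have "(\<Sum>k\<in>K. w k * a k powr p) powr (1 / p) \<le> (t powr p) powr (1 / p)"
      using le \<open>0 \<le> p\<close> w_nonneg by (intro powr_mono2) (auto simp: mean_gen_def intro!: sum_nonneg)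
    then show ?thesis using False t(1)
      by (simp add: scalar_mean_def mean_gen_def mean_gen_inv_def powr_powr)
  qed
qed

text \<open>For negative \<open>p\<close> the generator reverses order; passing to inverses turns
  the lower bound \<open>t\<close> into the upper bound \<open>inverse t\<close> at order
  \<open>- p\<close>.\<close>

lemma scalar_mean_ge:
  assumes a: "\<And>k. k \<in> K \<Longrightarrow> 0 < a k" and t: "0 < t" "\<And>k. k \<in> K \<Longrightarrow> w k \<noteq> 0 \<Longrightarrow> t \<le> a k"
  shows "t \<le> scalar_mean K w a p"
proof (cases "0 \<le> p")
  case False
  have "scalar_mean K w (\<lambda>k. inverse (a k)) (- p) \<le> inverse t"
    using a t False by (intro scalar_mean_le_nonneg) (auto intro: le_imp_inverse_le)
  moreover have "0 < scalar_mean K w (\<lambda>k. inverse (a k)) (- p)"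
    using a by (intro scalar_mean_pos) auto
  ultimately show ?thesis
    using a t(1) le_imp_inverse_le by (fastforce simp: scalar_mean_inverse[of a])
qed (use assms scalar_mean_ge_nonneg in auto)

lemma scalar_mean_le:
  assumes a: "\<And>k. k \<in> K \<Longrightarrow> 0 < a k" and t: "0 < t" "\<And>k. k \<in> K \<Longrightarrow> w k \<noteq> 0 \<Longrightarrow> a k \<le> t"
  shows "scalar_mean K w a p \<le> t"
proof (cases "0 \<le> p")
  case False
  have "inverse t \<le> scalar_mean K w (\<lambda>k. inverse (a k)) (- p)"
    using a t False by (intro scalar_mean_ge_nonneg) (auto intro: le_imp_inverse_le)
  then show ?thesis
    using a t(1) le_imp_inverse_le[of "inverse t"] by (fastforce simp: scalar_mean_inverse[of a])
qed (use assms scalar_mean_le_nonneg in auto)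

end

section \<open>Adjoints and unitary diagonalization\<close>

lemma cadjoint_nth [simp]: "cadjoint A $ i $ j = cnj (A $ j $ i)"
  by (simp add: cadjoint_def)

lemma cadjoint_cadjoint [simp]: "cadjoint (cadjoint A) = A"
  by (simp add: vec_eq_iff)

lemma cadjoint_mult: "cadjoint (A ** B) = cadjoint B ** cadjoint A"
  by (simp add: vec_eq_iff matrix_matrix_mult_def mult.commute)

lemma cadjoint_sum: "cadjoint (\<Sum>i\<in>I. f i) = (\<Sum>i\<in>I. cadjoint (f i))"
  by (simp add: vec_eq_iff)

lemma cadjoint_scaleR: "cadjoint (c *\<^sub>R A) = c *\<^sub>R cadjoint A"
  by (simp add: vec_eq_iff)

lemma cadjoint_real_diag [simp]: "cadjoint (real_diag d) = real_diag d"
  by (simp add: vec_eq_iff real_diag_def)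

lemma hermitian_conj_real_diag: "hermitian_mat (U ** real_diag d ** cadjoint U)"
  by (simp add: hermitian_mat_def cadjoint_mult matrix_mul_assoc)

lemma hermitian_sum_scaleR:
  assumes "\<And>i. i \<in> I \<Longrightarrow> hermitian_mat (f i)"
  shows "hermitian_mat (\<Sum>i\<in>I. c i *\<^sub>R f i)"
  using assms by (simp add: hermitian_mat_def cadjoint_sum cadjoint_scaleR)

lemma unitary_cadjoint: "unitary_mat U \<Longrightarrow> unitary_mat (cadjoint U)"
  by (simp add: unitary_mat_def)

text \<open>The real inner product \<open>\<bullet>\<close> on complex vectors is the real part of
  the Hermitian one, so adjoints move across it as usual.\<close>

lemma inner_matrix_vector:
  fixes x y :: "complex^'n" and M :: "complex^'n^'n"
  shows "x \<bullet> (M *v y) = (cadjoint M *v x) \<bullet> y"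
proof -
  have Re_cnj: "(a :: complex) \<bullet> b = Re (cnj a * b)" for a b
    by (simp add: inner_complex_def)
  have "x \<bullet> (M *v y) = Re (\<Sum>i\<in>UNIV. \<Sum>j\<in>UNIV. cnj (x $ i) * (M $ i $ j * y $ j))"
    by (simp add: inner_vec_def Re_cnj matrix_vector_mult_def sum_distrib_left del: inner_complex_def times_complex.simps complex_cnj)
  also have "\<dots> = Re (\<Sum>j\<in>UNIV. \<Sum>i\<in>UNIV. cnj (x $ i) * (M $ i $ j * y $ j))"
    by (subst sum.swap) simp
  also have "\<dots> = (cadjoint M *v x) \<bullet> y"
    by (simp add: inner_vec_def Re_cnj matrix_vector_mult_def sum_distrib_right sum_distrib_left algebra_simps)
  finally show ?thesis .
qed

lemma norm_unitary:
  assumes "unitary_mat U"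
  shows "norm (U *v x) = norm x"
proof -
  have "(U *v x) \<bullet> (U *v x) = x \<bullet> x"
    using assms by (simp add: inner_matrix_vector matrix_vector_mul_assoc unitary_mat_def)
  then show ?thesis by (simp add: norm_eq_sqrt_inner)
qed

lemma norm_sq_components: "(norm (x :: complex^'n))\<^sup>2 = (\<Sum>k\<in>UNIV. (cmod (x $ k))\<^sup>2)"
  by (simp add: power2_norm_eq_inner inner_vec_def)

lemma real_diag_vec: "(real_diag d *v x) $ k = complex_of_real (d k) * x $ k"
  by (simp add: real_diag_def matrix_vector_mult_def if_distrib[of "\<lambda>x. x * _"] cong: if_cong)

text \<open>Moving \<open>U\<close> across the product leaves \<open>real_diag d\<close> between two
  copies of \<open>cadjoint U *v x\<close>. For unitary \<open>U\<close> and unit \<open>x\<close>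
  the squared moduli sum to 1, so the form is a weighted mean of the \<open>d k\<close>.\<close>

lemma quadratic_form_diag:
  fixes x :: "complex^'n"
  shows "x \<bullet> ((U ** real_diag d ** cadjoint U) *v x) = (\<Sum>k\<in>UNIV. (cmod ((cadjoint U *v x) $ k))\<^sup>2 * d k)"
proof -
  have "x \<bullet> ((U ** real_diag d ** cadjoint U) *v x) = (cadjoint U *v x) \<bullet> (real_diag d *v (cadjoint U *v x))"
    by (simp add: inner_matrix_vector[of x U] flip: matrix_vector_mul_assoc)
  also have "\<dots> = (\<Sum>k\<in>UNIV. (cmod ((cadjoint U *v x) $ k))\<^sup>2 * d k)"
    unfolding inner_vec_def real_diag_vec
    by (intro sum.cong refl) (unfold cmod_power2, simp add: inner_complex_def power2_eq_square algebra_simps)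
  finally show ?thesis .
qed

lemma sum_unitary_components:
  fixes x :: "complex^'n"
  assumes "unitary_mat U"
  shows "(\<Sum>k\<in>UNIV. (cmod ((cadjoint U *v x) $ k))\<^sup>2) = (norm x)\<^sup>2"
  using norm_unitary[OF unitary_cadjoint[OF assms], of x] norm_sq_components[of "cadjoint U *v x"] by simp

lemma unitary_from_orthonormal:
  assumes "cadjoint U ** U = mat 1"
  shows "unitary_mat U"
  using assms matrix_left_right_inverse[of U "cadjoint U"] by (simp add: unitary_mat_def)

lemma matrix_vector_scaleR: "(A :: complex^'n^'n) *v (c *\<^sub>R x) = c *\<^sub>R (A *v x)"
  by (simp add: vec_eq_iff matrix_vector_mult_def scaleR_sum_right)

lemma posdef_qform: "posdef_mat A \<Longrightarrow> x \<noteq> 0 \<Longrightarrow> 0 < x \<bullet> (A *v x)"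
  by (simp add: posdef_mat_def inner_vec_def inner_complex_def)

section \<open>The spectral theorem for Hermitian matrices\<close>

definition cdot :: "complex^'n \<Rightarrow> complex^'n \<Rightarrow> complex" where
  "cdot x y = (\<Sum>i\<in>UNIV. cnj (x $ i) * y $ i)"

text \<open>Splits complex orthogonality into two real orthogonality conditions, to which the
  Euclidean theory of \<open>\<bullet>\<close> applies.\<close>

lemma cdot_eq_inner: "cdot x y = Complex (x \<bullet> y) ((\<i> *s x) \<bullet> y)"
  by (simp add: cdot_def complex_eq_iff inner_vec_def inner_complex_def algebra_simps)

text \<open>The vectors of \<open>S\<close> and their multiples by the imaginary unit span a real
  space of dimension at most \<open>2 * card S\<close>, less than the real dimension
  \<open>2 * CARD('n)\<close>.\<close>

lemma exists_orthogonal: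
  fixes S :: "(complex^'n) set"
  assumes "finite S" "card S < CARD('n)"
  shows "\<exists>x. norm x = 1 \<and> (\<forall>y\<in>S. cdot y x = 0)"
proof -
  let ?T = "S \<union> (\<lambda>y. \<i> *s y) ` S"
  have "dim ?T \<le> card ?T" using assms by (intro dim_le_card') auto
  also have "\<dots> \<le> card S + card S"
    using card_Un_le[of S "(\<lambda>y. \<i> *s y) ` S"] card_image_le[OF assms(1), of "\<lambda>y. \<i> *s y"] by linarith
  also have "\<dots> < DIM(complex^'n)" using assms by simp
  finally obtain x where x: "x \<noteq> 0" "\<And>y. y \<in> span ?T \<Longrightarrow> orthogonal x y"
    using orthogonal_to_subspace_exists by blast
  have "cdot y (x /\<^sub>R norm x) = 0" if "y \<in> S" for y
  proof -
    have "orthogonal x y" "orthogonal x (\<i> *s y)"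
      using that by (auto intro!: x(2) span_base)
    then show ?thesis by (simp add: cdot_eq_inner orthogonal_def inner_commute complex_eq_iff)
  qed
  moreover have "norm (x /\<^sub>R norm x) = 1" using x(1) by simp
  ultimately show ?thesis by blast
qed

lemma hermitian_inner: "hermitian_mat A \<Longrightarrow> (A *v x) \<bullet> y = x \<bullet> (A *v y)"
  by (simp add: inner_matrix_vector hermitian_mat_def)

lemma matrix_vector_mult_ii: "(A :: complex^'n^'n) *v (\<i> *s x) = \<i> *s (A *v x)"
  by (simp add: vec_eq_iff matrix_vector_mult_def sum_distrib_left algebra_simps)

text \<open>The orthogonal complement \<open>W\<close> of \<open>S\<close> is invariant under
  \<open>A\<close>, because \<open>S\<close> consists of eigenvectors with real eigenvalues. A
  maximizer of the quadratic form on the unit sphere of \<open>W\<close> is an eigenvector, by a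
  first-order variation inside \<open>W\<close>.\<close>

lemma eigenvector_orthogonal_exists:
  fixes A :: "complex^'n^'n"
  assumes A: "hermitian_mat A" and S: "finite S" "card S < CARD('n)"
    and eig: "\<And>u. u \<in> S \<Longrightarrow> \<exists>d. A *v u = d *\<^sub>R u"
  shows "\<exists>x d. norm x = 1 \<and> (\<forall>u\<in>S. cdot u x = 0) \<and> A *v x = d *\<^sub>R x"
proof -
  define W where "W = {x :: complex^'n. \<forall>u\<in>S. cdot u x = 0}"
  have W_eq: "W = (\<Inter>u\<in>S. {x. u \<bullet> x = 0} \<inter> {x. (\<i> *s u) \<bullet> x = 0})"
    by (auto simp: W_def cdot_eq_inner complex_eq_iff)
  have closed: "closed W" unfolding W_eq by (intro closed_INT closed_Int ballI closed_hyperplane)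
  have subW: "subspace W" unfolding W_eq
    by (auto simp: subspace_def inner_add_right)
  have AW: "A *v x \<in> W" if "x \<in> W" for x
  proof -
    have "cdot u (A *v x) = 0" if u: "u \<in> S" for u
    proof -
      obtain d where d: "A *v u = d *\<^sub>R u" using eig[OF u] by blast
      have "u \<bullet> (A *v x) = d * (u \<bullet> x)"
        using hermitian_inner[OF A, of u x] d by simp
      moreover have "(\<i> *s u) \<bullet> (A *v x) = (A *v (\<i> *s u)) \<bullet> x"
        using hermitian_inner[OF A, of "\<i> *s u" x] by (rule sym)
      moreover have "A *v (\<i> *s u) = d *\<^sub>R (\<i> *s u)"
        by (simp add: matrix_vector_mult_ii d vec_eq_iff)
      ultimately show ?thesis
        using \<open>x \<in> W\<close> u by (simp add: W_eq cdot_eq_inner complex_eq_iff)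
    qed
    then show ?thesis by (simp add: W_def)
  qed
  define K where "K = W \<inter> sphere 0 1"
  have "compact K" unfolding K_def using closed by (simp add: closed_Int_compact)
  moreover have "K \<noteq> {}" using exists_orthogonal[OF S] by (auto simp: K_def W_def)
  moreover have "continuous_on K (\<lambda>x. x \<bullet> (A *v x))"
    by (intro continuous_intros matrix_vector_mult_linear_continuous_on)
  ultimately have "\<exists>x\<in>K. \<forall>y\<in>K. y \<bullet> (A *v y) \<le> x \<bullet> (A *v x)"
    by (rule continuous_attains_sup)
  then obtain x where x: "x \<in> K" and max: "\<And>y. y \<in> K \<Longrightarrow> y \<bullet> (A *v y) \<le> x \<bullet> (A *v x)"
    by blast
  define \<mu> where "\<mu> = x \<bullet> (A *v x)"
  \<comment> \<open>The form of \<open>B\<close> is nonnegative on \<open>W\<close> and vanishes at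
    the maximizer \<open>x\<close>; the rest shows that this forces \<open>B x = 0\<close>.\<close>
  define B where "B = (\<lambda>y. \<mu> *\<^sub>R y - A *v y)"
  have xW: "x \<in> W" and nx: "norm x = 1" using x by (auto simp: K_def)
  have psd: "0 \<le> y \<bullet> B y" if "y \<in> W" for y
  proof (cases "y = 0")
    case False
    have "y /\<^sub>R norm y \<in> K" using that False subW by (simp add: K_def subspace_scale)
    from max[OF this] have "(y \<bullet> (A *v y)) / (norm y)\<^sup>2 \<le> \<mu>"
      by (simp add: \<mu>_def matrix_vector_scaleR power2_eq_square divide_inverse algebra_simps)
    then have "y \<bullet> (A *v y) \<le> \<mu> * (norm y)\<^sup>2" using False by (simp add: field_simps)
    then show ?thesis by (simp add: B_def inner_diff_right power2_norm_eq_inner)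
  qed (simp add: B_def)
  have BW: "B x \<in> W"
    unfolding B_def using xW AW subW by (intro subspace_diff subspace_scale) auto
  have xBx: "x \<bullet> B x = 0"
    using nx by (simp add: B_def inner_diff_right \<mu>_def norm_eq_1)
  have sym: "y \<bullet> B z = B y \<bullet> z" for y z
    by (simp add: B_def inner_diff_right inner_diff_left hermitian_inner[OF A])
  let ?b = "B x \<bullet> B x" and ?c = "B x \<bullet> B (B x)"
  \<comment> \<open>Variation of \<open>x\<close> in the direction \<open>B x\<close>: the constant
    term vanishes, and the linear coefficient is twice the squared norm of
    \<open>B x\<close>.\<close>
  have quad: "0 \<le> 2 * s * ?b + s\<^sup>2 * ?c" for s
  proof -
    have "0 \<le> (x + s *\<^sub>R B x) \<bullet> B (x + s *\<^sub>R B x)"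
      using xW BW subW by (intro psd subspace_add subspace_scale) auto
    also have "B (x + s *\<^sub>R B x) = B x + s *\<^sub>R B (B x)"
      by (simp add: B_def matrix_vector_right_distrib matrix_vector_mult_diff_distrib matrix_vector_scaleR algebra_simps)
    also have "(x + s *\<^sub>R B x) \<bullet> (B x + s *\<^sub>R B (B x)) = 2 * s * ?b + s\<^sup>2 * ?c"
      using xBx sym[of x "B x"] by (simp add: inner_add_left inner_add_right power2_eq_square algebra_simps)
    finally show ?thesis .
  qed
  have "?b = 0"
  proof -
    have c: "0 \<le> ?c" using psd[OF BW] .
    \<comment> \<open>A negative step small enough for the linear term to dominate; the 1 in the
      denominator keeps it positive when \<open>?c = 0\<close>.\<close>
    define s where "s = - ?b / (?c + 1)"
    have b: "?b = - s * (?c + 1)" using c by (simp add: s_def)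
    have "0 \<le> - s\<^sup>2 * (?c + 2)"
      using quad[of s] unfolding b by (simp add: power2_eq_square algebra_simps)
    then have "s = 0" using c by (simp add: mult_le_0_iff)
    then show ?thesis using b by simp
  qed
  then have "A *v x = \<mu> *\<^sub>R x" by (simp add: B_def)
  then show ?thesis using xW nx by (auto simp: W_def)
qed

text \<open>Induction on \<open>k\<close>: each new unit eigenvector is taken orthogonal to those
  already found.\<close>

lemma orthonormal_eigenvectors:
  fixes A :: "complex^'n^'n"
  assumes A: "hermitian_mat A" and "k \<le> CARD('n)"
  shows "\<exists>u d. (\<forall>i<k. A *v u i = d i *\<^sub>R u i) \<and> (\<forall>i<k. \<forall>j<k. cdot (u i) (u j) = (if i = j then 1 else 0))"
  using assms(2)
proof (induction k)
  case (Suc k)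
  then obtain u d where u: "\<forall>i<k. A *v u i = d i *\<^sub>R u i"
    "\<forall>i<k. \<forall>j<k. cdot (u i) (u j) = (if i = j then 1 else 0)"
    by auto
  have "card (u ` {..<k}) < CARD('n)"
    using Suc.prems card_image_le[of "{..<k}" u] by simp
  moreover have "\<exists>c. A *v v = c *\<^sub>R v" if "v \<in> u ` {..<k}" for v
    using that u(1) by blast
  ultimately obtain x e where x: "norm x = 1" "\<forall>i<k. cdot (u i) x = 0" "A *v x = e *\<^sub>R x"
    using eigenvector_orthogonal_exists[OF A finite_imageI[OF finite_lessThan], of u k] by auto
  have "cdot x (u i) = cnj (cdot (u i) x)" for i
    by (simp add: cdot_def mult.commute)
  then have x': "\<forall>i<k. cdot x (u i) = 0" using x(2) by simp
  \<comment> \<open>The imaginary part of \<open>cdot x x\<close>; the real part is the squared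
    norm.\<close>
  have "(\<i> *s x) \<bullet> x = 0"
    by (simp add: inner_vec_def inner_complex_def)
  then have "cdot x x = 1" using x(1) by (simp add: cdot_eq_inner norm_eq_1 complex_eq_iff)
  define u' d' where "u' = u(k := x)" and "d' = d(k := e)"
  have "\<forall>i<Suc k. A *v u' i = d' i *\<^sub>R u' i"
    using u(1) x(3) by (simp add: u'_def d'_def less_Suc_eq)
  moreover have "cdot (u' i) (u' j) = (if i = j then 1 else 0)" if "i < Suc k" "j < Suc k" for i j
    using that u(2) x(2) x' \<open>cdot x x = 1\<close> by (cases "i = k"; cases "j = k") (simp_all add: u'_def)
  ultimately show ?case by blast
qed simp

lemma spectral_theorem:
  fixes A :: "complex^'n^'n"
  assumes "hermitian_mat A"
  obtains U d where "unitary_mat U" "A = U ** real_diag d ** cadjoint U"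
proof -
  obtain u d where u: "\<forall>i<CARD('n). A *v u i = d i *\<^sub>R u i"
    "\<forall>i<CARD('n). \<forall>j<CARD('n). cdot (u i) (u j) = (if i = j then 1 else 0)"
    using orthonormal_eigenvectors[OF assms order.refl] by blast
  obtain g :: "'n \<Rightarrow> nat" where g: "bij_betw g UNIV {..<CARD('n)}"
    using ex_bij_betw_finite_nat[of "UNIV :: 'n set"] by (auto simp: lessThan_atLeast0)
  then have g_less: "g i < CARD('n)" and g_inj: "g i = g j \<longleftrightarrow> i = j" for i j
    by (auto simp: bij_betw_def inj_eq)
  define U :: "complex^'n^'n" where "U = (\<chi> i j. u (g j) $ i)"
  have "(cadjoint U ** U) $ i $ j = cdot (u (g i)) (u (g j))" for i j
    by (simp add: U_def matrix_matrix_mult_def cdot_def)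
  then have "cadjoint U ** U = mat 1"
    using u(2) g_less g_inj by (simp add: vec_eq_iff mat_def)
  then have U: "unitary_mat U" by (rule unitary_from_orthonormal)
  have "(A ** U) $ i $ j = (A *v u (g j)) $ i" for i j
    by (simp add: U_def matrix_matrix_mult_def matrix_vector_mult_def)
  then have "A ** U = U ** real_diag (d \<circ> g)"
    using u(1) g_less by (simp add: vec_eq_iff real_diag_mult_right U_def scaleR_conv_of_real[where 'a = complex] mult.commute)
  then have "A ** (U ** cadjoint U) = U ** real_diag (d \<circ> g) ** cadjoint U"
    by (simp add: matrix_mul_assoc)
  then have "A = U ** real_diag (d \<circ> g) ** cadjoint U"
    using U by (simp add: unitary_mat_def)
  then show ?thesis using U that by blast
qed

section \<open>Eigenvalues in decreasing order\<close>

text \<open>Embedding scalars as constant polynomials respects products, so a unitary similarity of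
  matrices lifts to a similarity of their characteristic matrices.\<close>

lemma const_poly_matrix_mult:
  "map_matrix (\<lambda>a. [:a:]) ((A :: complex^'n^'n) ** B) = map_matrix (\<lambda>a. [:a:]) A ** map_matrix (\<lambda>a. [:a:]) B"
proof -
  have "[:sum f S:] = (\<Sum>i\<in>S. [:f i:])" for f :: "'n \<Rightarrow> complex" and S
  proof (induction S rule: infinite_finite_induct)
    case (insert x F)
    then show ?case by (simp flip: insert.IH)
  qed auto
  then show ?thesis by (simp add: vec_eq_iff matrix_matrix_mult_def mult.commute)
qed

lemma const_poly_matrix_one: "map_matrix (\<lambda>a. [:a:]) (mat 1 :: complex^'n^'n) = mat 1"
  by (simp add: vec_eq_iff mat_def one_pCons)

lemma mat_mult_nth: "(mat x ** (M :: 'a::comm_ring_1^'n^'n)) $ i $ j = x * M $ i $ j"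
  by (simp add: mat_def matrix_matrix_mult_def if_distrib[of "\<lambda>x. x * _"] cong: if_cong)

lemma mult_mat_nth: "((M :: 'a::comm_ring_1^'n^'n) ** mat x) $ i $ j = M $ i $ j * x"
  by (simp add: mat_def matrix_matrix_mult_def if_distrib[of "\<lambda>x. _ * x"] cong: if_cong)

lemma mat_commute: "mat x ** M = (M :: 'a::comm_ring_1^'n^'n) ** mat x"
  by (simp add: vec_eq_iff mat_mult_nth mult_mat_nth mult.commute)

lemma matrix_diff_ldistrib: "A ** (B - C) = A ** B - A ** (C :: 'a::comm_ring_1^'n^'n)"
  by (simp add: vec_eq_iff matrix_matrix_mult_def right_diff_distrib sum_subtractf)

lemma matrix_diff_rdistrib: "(A - B) ** C = A ** C - B ** (C :: 'a::comm_ring_1^'n^'n)"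
  by (simp add: vec_eq_iff matrix_matrix_mult_def left_diff_distrib sum_subtractf)

text \<open>The scalar matrix of the indeterminate commutes with everything, so the characteristic
  matrix is conjugate to a diagonal one and has the same determinant.\<close>

lemma charpoly_unitary_diag:
  fixes U :: "complex^'n^'n"
  assumes U: "unitary_mat U"
  shows "charpoly (U ** real_diag d ** cadjoint U) = (\<Prod>k\<in>UNIV. [:- complex_of_real (d k), 1:])"
proof -
  let ?C = "map_matrix (\<lambda>a :: complex. [:a:]) :: complex^'n^'n \<Rightarrow> complex poly^'n^'n"
  let ?X = "mat [:0, 1:] :: complex poly^'n^'n"
  have CU: "?C U ** ?C (cadjoint U) = mat 1"
    using U by (simp add: unitary_mat_def const_poly_matrix_one flip: const_poly_matrix_mult)
  have "?C U ** (?X - ?C (real_diag d)) ** ?C (cadjoint U)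
      = ?C U ** ?X ** ?C (cadjoint U) - ?C U ** ?C (real_diag d) ** ?C (cadjoint U)"
    by (simp only: matrix_diff_ldistrib matrix_diff_rdistrib)
  also have "?C U ** ?X ** ?C (cadjoint U) = ?X ** (?C U ** ?C (cadjoint U))"
    by (simp only: mat_commute[symmetric] matrix_mul_assoc)
  also have "\<dots> = ?X" by (simp add: CU)
  also have "?C U ** ?C (real_diag d) ** ?C (cadjoint U) = ?C (U ** real_diag d ** cadjoint U)"
    by (simp only: const_poly_matrix_mult)
  finally have "charpoly (U ** real_diag d ** cadjoint U)
      = det (?C U ** (?X - ?C (real_diag d)) ** ?C (cadjoint U))"
    by (simp add: charpoly_def)
  also have "\<dots> = det (?C U ** ?C (cadjoint U)) * det (?X - ?C (real_diag d))"
    by (simp add: det_mul)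
  also have "\<dots> = det (?X - ?C (real_diag d))" by (simp add: CU)
  also have "\<dots> = (\<Prod>k\<in>UNIV. (?X - ?C (real_diag d)) $ k $ k)"
    by (rule det_diagonal) (simp add: mat_def real_diag_def)
  finally show ?thesis by (simp add: mat_def real_diag_def)
qed

text \<open>The factored characteristic polynomial has exactly the roots \<open>d k\<close>.
  \<open>eigval\<close> counts positions from 1 and \<open>g\<close> from 0, whence
  \<open>Suc i\<close>.\<close>

lemma eigval_sorted_diag:
  fixes U :: "complex^'n^'n" and g :: "nat \<Rightarrow> 'n"
  assumes U: "unitary_mat U" and g: "bij_betw g {..<CARD('n)} UNIV"
    and dec: "\<And>i j. i \<le> j \<Longrightarrow> j < CARD('n) \<Longrightarrow> d (g j) \<le> d (g i)"
    and i: "i < CARD('n)"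
  shows "eigval (Suc i) (U ** real_diag d ** cadjoint U) = d (g i)"
proof -
  let ?L = "map (\<lambda>i. d (g i)) [0..<CARD('n)]"
  have "proots (charpoly (U ** real_diag d ** cadjoint U)) = (\<Sum>k\<in>UNIV. {#complex_of_real (d k)#})"
    unfolding charpoly_unitary_diag[OF U] by (subst proots_prod) auto
  also have "\<dots> = (\<Sum>i<CARD('n). {#complex_of_real (d (g i))#})"
    by (rule sum.reindex_bij_betw[OF g, symmetric])
  also have "\<dots> = image_mset complex_of_real (mset ?L)"
  proof -
    have "(\<Sum>i<m. {#f i#}) = mset (map f [0..<m])" for f :: "nat \<Rightarrow> complex" and m
      by (induction m) simp_all
    then show ?thesis by (simp add: multiset.map_comp comp_def)
  qed
  finally have "image_mset Re (proots (charpoly (U ** real_diag d ** cadjoint U))) = mset ?L"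
    by (simp add: multiset.map_comp comp_def)
  \<comment> \<open>\<open>?L\<close> decreases, so sorting reverses it, and the \<open>rev\<close>
    inside \<open>eigval\<close> restores it.\<close>
  moreover have "sort ?L = rev ?L"
    using dec by (intro properties_for_sort) (auto simp: sorted_wrt_iff_nth_less rev_nth)
  ultimately show ?thesis using i by (simp add: eigval_def del: mset_map)
qed

section \<open>Rearranging a diagonalization\<close>

lemma permute_unitary:
  fixes U :: "complex^'n^'n"
  assumes U: "unitary_mat U" and \<pi>: "bij \<pi>"
  shows "unitary_mat (\<chi> i j. U $ i $ \<pi> j)"
proof (rule unitary_from_orthonormal)
  have "(cadjoint (\<chi> i j. U $ i $ \<pi> j) ** (\<chi> i j. U $ i $ \<pi> j)) $ a $ b = (cadjoint U ** U) $ \<pi> a $ \<pi> b" for a b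
    by (simp add: matrix_matrix_mult_def)
  then show "cadjoint (\<chi> i j. U $ i $ \<pi> j) ** (\<chi> i j. U $ i $ \<pi> j) = mat 1"
    using U bij_is_inj[OF \<pi>] by (simp add: vec_eq_iff unitary_mat_def mat_def inj_eq)
qed

lemma conj_diag_nth:
  "(U ** real_diag d ** cadjoint U) $ a $ b = (\<Sum>k\<in>UNIV. U $ a $ k * complex_of_real (d k) * cnj (U $ b $ k))"
  by (subst matrix_matrix_mult_def) (simp add: real_diag_mult_right)

lemma permute_diag:
  fixes U :: "complex^'n^'n"
  assumes \<pi>: "bij \<pi>"
  shows "(\<chi> i j. U $ i $ \<pi> j) ** real_diag (\<lambda>k. d (\<pi> k)) ** cadjoint (\<chi> i j. U $ i $ \<pi> j) = U ** real_diag d ** cadjoint U"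
  using sum.reindex_bij_betw[OF \<pi>, of "\<lambda>k. U $ _ $ k * complex_of_real (d k) * cnj (U $ _ $ k)"]
  by (simp add: vec_eq_iff conj_diag_nth)

text \<open>The enumeration \<open>g\<close> stays fixed and \<open>d\<close> is rearranged along
  it, so that eigenvalues of different matrices can be compared at the same index.\<close>

lemma decreasing_rearrangement:
  fixes d :: "'n::finite \<Rightarrow> real" and g :: "nat \<Rightarrow> 'n"
  assumes g: "bij_betw g {..<CARD('n)} UNIV"
  obtains \<pi> where "bij \<pi>" "\<And>i j. i \<le> j \<Longrightarrow> j < CARD('n) \<Longrightarrow> d (\<pi> (g j)) \<le> d (\<pi> (g i))"
proof -
  obtain xs :: "'n list" where xs: "set xs = UNIV" "distinct xs"
    using finite_distinct_list[of "UNIV :: 'n set"] by auto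
  define ys where "ys = rev (sort_key d xs)"
  have ys: "distinct ys" "set ys = UNIV" using xs by (auto simp: ys_def)
  then have len: "length ys = CARD('n)" by (metis distinct_card)
  have "sorted (map d (rev ys))" by (simp add: ys_def)
  then have dec: "d (ys ! j) \<le> d (ys ! i)" if "i \<le> j" "j < CARD('n)" for i j
    using that len sorted_rev_nth_mono[of "map d ys" i j] by (simp add: rev_map)
  have bij: "bij_betw ((!) ys) {..<CARD('n)} UNIV"
    using bij_betw_nth[OF ys(1), of "{..<CARD('n)}" UNIV] ys(2) len by auto
  \<comment> \<open>Sends \<open>g i\<close> to the \<open>i\<close>-th entry of the decreasingly
    sorted list \<open>ys\<close>.\<close>
  define \<pi> where "\<pi> = (!) ys \<circ> the_inv_into {..<CARD('n)} g"
  have "bij \<pi>"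
    unfolding \<pi>_def using bij_betw_trans[OF bij_betw_the_inv_into[OF g] bij] .
  moreover have "\<pi> (g i) = ys ! i" if "i < CARD('n)" for i
    using that g by (simp add: \<pi>_def bij_betw_def the_inv_into_f_f)
  ultimately show ?thesis using that dec by simp
qed

section \<open>Unitarily invariant norms of diagonal matrices\<close>

lemma unitarily_invariant_norm_conj:
  assumes "unitarily_invariant_norm N" "unitary_mat U"
  shows "N (U ** X ** cadjoint U) = N X"
  using assms unitary_cadjoint by (auto simp: unitarily_invariant_norm_def)

text \<open>The unitary \<open>?J\<close> negates coordinate \<open>k\<close>, so the entries
  \<open>t\<close> and \<open>- t\<close> give the same norm; \<open>s\<close> lies between them,
  and the norm is convex.\<close>

lemma unitarily_invariant_norm_diag_update:
  fixes N :: "complex^'n^'n \<Rightarrow> real"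
  assumes N: "unitarily_invariant_norm N" and st: "0 \<le> s" "s \<le> t"
  shows "N (real_diag (d(k := s))) \<le> N (real_diag (d(k := t)))"
proof (cases "t = 0")
  case False
  then have t: "0 < t" using st by simp
  let ?X = "real_diag (d(k := t)) :: complex^'n^'n" and ?Y = "real_diag (d(k := - t)) :: complex^'n^'n"
  let ?J = "real_diag ((\<lambda>_. 1)(k := - 1)) :: complex^'n^'n"
  have J: "unitary_mat ?J"
    by (intro unitary_from_orthonormal) (simp add: vec_eq_iff real_diag_mult_left, simp add: real_diag_def mat_def)
  have "?Y = ?J ** ?X ** mat 1"
    by (simp add: vec_eq_iff real_diag_mult_left, simp add: real_diag_def)
  moreover have "unitary_mat (mat 1 :: complex^'n^'n)"
  proof -
    have "cadjoint (mat 1) = (mat 1 :: complex^'n^'n)" by (simp add: vec_eq_iff mat_def)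
    then show ?thesis by (simp add: unitary_mat_def)
  qed
  then have "N (?J ** ?X ** mat 1) = N ?X"
    using N J unfolding unitarily_invariant_norm_def by blast
  ultimately have NY: "N ?Y = N ?X" by simp
  \<comment> \<open>Solution of \<open>a + b = 1\<close> and \<open>(a - b) * t = s\<close>; both
    are nonnegative because \<open>0 \<le> s \<le> t\<close>.\<close>
  define a b where "a = (1 + s / t) / 2" and "b = (1 - s / t) / 2"
  have ab: "0 \<le> a" "0 \<le> b" "a + b = 1" "a * t - b * t = s"
    using st t by (auto simp: a_def b_def field_simps)
  have "real_diag (d(k := s)) = map_matrix ((*) (complex_of_real a)) ?X + map_matrix ((*) (complex_of_real b)) ?Y"
  proof -
    have "complex_of_real s = of_real a * of_real t - of_real b * of_real t"
      using arg_cong[OF ab(4), of complex_of_real] by simp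
    moreover have "of_real a * z + of_real b * z = z" for z :: complex
      using arg_cong[OF ab(3), of complex_of_real] by (simp flip: distrib_right)
    ultimately show ?thesis
      by (auto simp: vec_eq_iff real_diag_def)
  qed
  then have "N (real_diag (d(k := s))) \<le> cmod (complex_of_real a) * N ?X + cmod (complex_of_real b) * N ?Y"
    using N unfolding unitarily_invariant_norm_def matrix_norm_def by (metis (no_types, lifting))
  also have "\<dots> = (a + b) * N ?X"
    using ab(1,2) NY by (simp add: distrib_right)
  finally show ?thesis using ab by simp
qed (use st in simp)

text \<open>The entries are lowered from \<open>b k\<close> to \<open>a k\<close> one at a time;
  \<open>S\<close> is the set of positions already lowered.\<close>

lemma unitarily_invariant_norm_diag_mono:
  fixes N :: "complex^'n^'n \<Rightarrow> real"
  assumes N: "unitarily_invariant_norm N" and ab: "\<And>k. 0 \<le> a k" "\<And>k. a k \<le> b k"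
  shows "N (real_diag a) \<le> N (real_diag b)"
proof -
  have "N (real_diag (\<lambda>k. if k \<in> S then a k else b k)) \<le> N (real_diag b)" for S
  proof (induction S rule: finite_induct[OF finite])
    case (2 k S)
    let ?d = "\<lambda>j. if j \<in> S then a j else b j"
    have "(\<lambda>j. if j \<in> insert k S then a j else b j) = ?d(k := a k)" "?d = ?d(k := b k)"
      using 2 by auto
    then have "N (real_diag (\<lambda>j. if j \<in> insert k S then a j else b j)) \<le> N (real_diag ?d)"
      using unitarily_invariant_norm_diag_update[OF N ab(1)[of k] ab(2)[of k], of ?d k] by metis
    then show ?case using 2 by linarith
  qed simp
  from this[of UNIV] show ?thesis by simp
qed

section \<open>Dimension count\<close>

text \<open>There are \<open>CARD('n) - 1 - j\<close> conditions from \<open>U\<close> and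
  \<open>j\<close> from \<open>V\<close>, one fewer than the dimension. Positions count from 0, and
  position \<open>j\<close> itself is left free on both sides.\<close>

lemma exists_vector_in_both_spans:
  fixes U V :: "complex^'n^'n"
  assumes "j < CARD('n)"
  shows "\<exists>x. norm x = 1 \<and> (\<forall>i. j < i \<and> i < CARD('n) \<longrightarrow> (cadjoint U *v x) $ (g i) = 0)
    \<and> (\<forall>i<j. (cadjoint V *v x) $ (h i) = 0)"
proof -
  have col: "cdot (column k M) x = (cadjoint M *v x) $ k" for k and M :: "complex^'n^'n" and x
    by (simp add: cdot_def column_def matrix_vector_mult_def)
  let ?S = "(\<lambda>i. column (g i) U) ` {j<..<CARD('n)} \<union> (\<lambda>i. column (h i) V) ` {..<j}"
  have "card ?S \<le> card {j<..<CARD('n)} + card {..<j}"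
    by (intro order.trans[OF card_Un_le] add_mono card_image_le) auto
  also have "\<dots> < CARD('n)" using assms by simp
  finally obtain x where "norm x = 1" "\<forall>y\<in>?S. cdot y x = 0"
    using exists_orthogonal[of ?S] by auto
  then show ?thesis by (intro exI[of _ x]) (auto simp: ball_Un col)
qed

section \<open>The limit at \<open>0\<close>\<close>

lemma tendsto_matrix_mult:
  fixes f g :: "'a \<Rightarrow> complex^'n^'n"
  assumes "(f \<longlongrightarrow> a) F" "(g \<longlongrightarrow> b) F"
  shows "((\<lambda>x. f x ** g x) \<longlongrightarrow> a ** b) F"
  using assms by (auto intro!: vec_tendstoI tendsto_intros simp: matrix_matrix_mult_def)

lemma tendsto_cadjoint:
  assumes "(f \<longlongrightarrow> a) F"
  shows "((\<lambda>x. cadjoint (f x)) \<longlongrightarrow> cadjoint a) F"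
  using assms by (auto intro!: vec_tendstoI tendsto_intros simp: cadjoint_def)

lemma tendsto_real_diag:
  fixes d :: "'n::finite \<Rightarrow> real"
  assumes "\<And>k. ((\<lambda>x. f x k) \<longlongrightarrow> d k) F"
  shows "((\<lambda>x. real_diag (f x)) \<longlongrightarrow> real_diag d) F"
  using assms by (auto intro!: vec_tendstoI tendsto_intros simp: real_diag_def)

text \<open>All rows are unit vectors. The bound supplies the compactness for extracting convergent
  subsequences.\<close>

lemma norm_unitary_mat_le:
  fixes U :: "complex^'n^'n"
  assumes "unitary_mat U"
  shows "norm U \<le> CARD('n)"
proof -
  have "norm (U $ i) = 1" for i
  proof -
    have "complex_of_real ((norm (U $ i))\<^sup>2) = (U ** cadjoint U) $ i $ i"
      by (simp add: norm_sq_components matrix_matrix_mult_def complex_norm_square del: of_real_power)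
    also have "\<dots> = 1" using assms by (simp add: unitary_mat_def mat_def)
    finally have "(norm (U $ i))\<^sup>2 = 1" by (simp only: of_real_eq_1_iff)
    then show ?thesis by (simp add: power2_eq_1_iff) (smt (verit) norm_ge_zero)
  qed
  then show ?thesis
    using L2_set_le_sum[of UNIV "\<lambda>i. norm (U $ i)"] by (simp add: norm_vec_def)
qed

lemma unitary_convergent_subsequence:
  fixes U :: "nat \<Rightarrow> complex^'n^'n"
  assumes "\<And>n. unitary_mat (U n)"
  obtains V r where "unitary_mat V" "strict_mono (r :: nat \<Rightarrow> nat)" "(\<lambda>n. U (r n)) \<longlonglongrightarrow> V"
proof -
  have "\<forall>n. U n \<in> cball 0 (CARD('n))"
    using norm_unitary_mat_le[OF assms] by simp
  then obtain V r where r: "strict_mono (r :: nat \<Rightarrow> nat)" "(U \<circ> r) \<longlonglongrightarrow> V"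
    using compact_cball unfolding compact_def by metis
  then have lim: "(\<lambda>n. U (r n)) \<longlonglongrightarrow> V" by (simp add: comp_def)
  have "(\<lambda>n. cadjoint (U (r n)) ** U (r n)) \<longlonglongrightarrow> cadjoint V ** V"
    by (intro tendsto_matrix_mult tendsto_cadjoint lim)
  then have "(\<lambda>n. mat 1) \<longlonglongrightarrow> cadjoint V ** V"
    using assms by (simp add: unitary_mat_def)
  then have "unitary_mat V"
    by (intro unitary_from_orthonormal) (simp add: LIMSEQ_const_iff)
  then show ?thesis using r(1) lim that by blast
qed

text \<open>Without convergence, some subsequence stays at distance at least \<open>e\<close> from
  \<open>L\<close>, and none of its subsequences can converge to \<open>L\<close>.\<close>

lemma tendsto_if_subsequences:
  fixes X :: "nat \<Rightarrow> 'a::metric_space"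
  assumes "\<And>r. strict_mono (r :: nat \<Rightarrow> nat) \<Longrightarrow> \<exists>s. strict_mono (s :: nat \<Rightarrow> nat) \<and> (\<lambda>n. X (r (s n))) \<longlonglongrightarrow> L"
  shows "X \<longlonglongrightarrow> L"
proof (rule ccontr)
  assume "\<not> X \<longlonglongrightarrow> L"
  then obtain e where e: "e > 0" "\<not> (\<forall>\<^sub>F n in sequentially. dist (X n) L < e)"
    by (auto simp: tendsto_iff)
  then have "infinite {n. \<not> dist (X n) L < e}"
    by (simp add: eventually_sequentially infinite_nat_iff_unbounded_le)
  then obtain r where r: "strict_mono (r :: nat \<Rightarrow> nat)" "\<forall>n. r n \<in> {n. \<not> dist (X n) L < e}"
    using infinite_enumerate by blast
  obtain s where "(\<lambda>n. X (r (s n))) \<longlonglongrightarrow> L" using assms[OF r(1)] by blast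
  then have "\<forall>\<^sub>F n in sequentially. dist (X (r (s n))) L < e"
    using e(1) by (auto simp: tendsto_iff)
  then show False using r(2) by (auto simp: eventually_sequentially)
qed

lemma conj_diag_affine:
  fixes U :: "complex^'n^'n"
  assumes "unitary_mat U"
  shows "U ** real_diag (\<lambda>k. 1 + p * h k) ** cadjoint U = mat 1 + p *\<^sub>R (U ** real_diag h ** cadjoint U)"
proof -
  have "U ** real_diag (\<lambda>k. 1 + p * h k) ** cadjoint U = U ** cadjoint U + p *\<^sub>R (U ** real_diag h ** cadjoint U)"
    by (simp add: vec_eq_iff conj_diag_nth) (simp add: matrix_matrix_mult_def sum.distrib[symmetric] scaleR_conv_of_real[where 'a = complex] sum_distrib_left algebra_simps)
  then show ?thesis using assms by (simp add: unitary_mat_def)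
qed

lemma conj_conj_diag:
  assumes "unitary_mat U"
  shows "cadjoint U ** (U ** D ** cadjoint U) ** U = D"
  using assms by (simp add: unitary_mat_def matrix_mul_assoc) (simp add: matrix_mul_assoc[symmetric])

lemma tendsto_powr_diff_quotient:
  fixes a :: real
  assumes "0 < a"
  shows "((\<lambda>p. (a powr p - 1) / p) \<longlongrightarrow> ln a) (at 0)"
proof -
  have "((\<lambda>p. a powr p) has_real_derivative ln a) (at 0)"
    using assms by (auto intro!: derivative_eq_intros)
  then show ?thesis using assms by (simp add: DERIV_def)
qed

text \<open>After taking logarithms, \<open>ln (1 + x) = x + O(x^2)\<close> at
  \<open>x = p n * g n\<close> leaves, after division by \<open>p n\<close>, an error of order
  \<open>p n * (g n)^2\<close>.\<close>

lemma tendsto_powr_inverse_exp: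
  fixes p g :: "nat \<Rightarrow> real"
  assumes p: "p \<longlonglongrightarrow> 0" "\<And>n. p n \<noteq> 0" and g: "g \<longlonglongrightarrow> c" and pos: "\<And>n. 0 < 1 + p n * g n"
  shows "(\<lambda>n. (1 + p n * g n) powr (1 / p n)) \<longlonglongrightarrow> exp c"
proof -
  have pg: "(\<lambda>n. p n * g n) \<longlonglongrightarrow> 0"
    using tendsto_mult[OF p(1) g] by simp
  have "(\<lambda>n. ln (1 + p n * g n) / p n - g n) \<longlonglongrightarrow> 0"
  proof (rule Lim_null_comparison)
    show "\<forall>\<^sub>F n in sequentially. norm (ln (1 + p n * g n) / p n - g n) \<le> 2 * \<bar>p n\<bar> * (g n)\<^sup>2"
    proof -
      \<comment> \<open>Range in which the quadratic bound for the logarithm is applied.\<close>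
      have "\<forall>\<^sub>F n in sequentially. \<bar>p n * g n\<bar> < 1 / 2"
        using tendstoD[OF pg, of "1/2"] by (simp add: dist_real_def)
      then show ?thesis
      proof eventually_elim
        case (elim n)
        then have "\<bar>ln (1 + p n * g n) - p n * g n\<bar> \<le> 2 * (p n * g n)\<^sup>2"
          by (intro abs_ln_one_plus_x_minus_x_bound) simp
        then have "\<bar>ln (1 + p n * g n) - p n * g n\<bar> / \<bar>p n\<bar> \<le> 2 * (p n * g n)\<^sup>2 / \<bar>p n\<bar>"
          by (rule divide_right_mono) simp
        also have "2 * (p n * g n)\<^sup>2 / \<bar>p n\<bar> = 2 * \<bar>p n\<bar> * (g n)\<^sup>2"
          using p(2)[of n] by (simp add: power_mult_distrib power2_eq_square abs_if field_simps)
        also have "\<bar>ln (1 + p n * g n) - p n * g n\<bar> / \<bar>p n\<bar> = norm (ln (1 + p n * g n) / p n - g n)"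
          using p(2)[of n] by (simp add: field_simps flip: abs_divide)
        finally show ?case .
      qed
    qed
    have "(\<lambda>n. 2 * \<bar>p n\<bar> * (g n)\<^sup>2) \<longlonglongrightarrow> 2 * \<bar>0\<bar> * c\<^sup>2"
      by (intro tendsto_intros p g)
    then show "(\<lambda>n. 2 * \<bar>p n\<bar> * (g n)\<^sup>2) \<longlonglongrightarrow> 0" by simp
  qed
  from tendsto_add[OF this g] have "(\<lambda>n. ln (1 + p n * g n) / p n) \<longlonglongrightarrow> c" by simp
  then have "(\<lambda>n. exp (ln (1 + p n * g n) / p n)) \<longlonglongrightarrow> exp c" by (rule tendsto_exp)
  moreover have "exp (ln (1 + p n * g n) / p n) = (1 + p n * g n) powr (1 / p n)" for n
    using pos[of n] by (simp add: powr_def)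
  ultimately show ?thesis by simp
qed

section \<open>Power means of positive definite matrices\<close>

lemma mean_gen_gen_inv: "p = 0 \<or> 0 < y \<Longrightarrow> mean_gen p (mean_gen_inv p y) = y"
  by (auto simp: mean_gen_def mean_gen_inv_def powr_powr)

lemma mean_gen_inv_pos: "p = 0 \<or> 0 < y \<Longrightarrow> 0 < mean_gen_inv p y"
  by (auto simp: mean_gen_inv_def)

lemma power_mean_eq:
  "power_mean m \<alpha> A p = fun_calculus (mean_gen_inv p) (\<Sum>i=1..m. \<alpha> i *\<^sub>R fun_calculus (mean_gen p) (A i))"
  by (cases "p = 0")
    (simp_all add: power_mean_def mat_exp_def mat_ln_def mat_powr_def mean_gen_def[abs_def] mean_gen_inv_def[abs_def])

lemma posdef_diagonalization:
  fixes A :: "complex^'n^'n"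
  assumes "posdef_mat A"
  obtains W a where "unitary_mat W" "\<And>k. 0 < a k" "\<And>f. fun_calculus f A = W ** real_diag (\<lambda>k. f (a k)) ** cadjoint W"
proof -
  obtain W a where W: "unitary_mat W" and A: "A = W ** real_diag a ** cadjoint W"
    using spectral_theorem assms unfolding posdef_mat_def by blast
  have "0 < a k" for k
  proof -
    \<comment> \<open>The \<open>k\<close>-th column of \<open>W\<close>, an eigenvector at which
      the quadratic form equals \<open>a k\<close>.\<close>
    let ?x = "W *v axis k 1"
    have x: "cadjoint W *v ?x = axis k 1"
      using W by (simp add: matrix_vector_mul_assoc unitary_mat_def)
    have "0 < ?x \<bullet> (A *v ?x)"
    proof (rule posdef_qform[OF assms])
      have "axis k 1 \<noteq> (0 :: complex^'n)" by (simp add: axis_eq_0_iff)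
      then show "?x \<noteq> 0" using x by auto
    qed
    also have "?x \<bullet> (A *v ?x) = (\<Sum>j\<in>UNIV. (cmod (axis k 1 $ j))\<^sup>2 * a j)"
      unfolding A quadratic_form_diag x ..
    also have "\<dots> = (\<Sum>j\<in>UNIV. if j = k then a j else 0)"
      by (intro sum.cong) (auto simp: axis_def)
    finally show ?thesis by simp
  qed
  then show ?thesis using that[OF W] fun_calculus_eqI[OF W A] by blast
qed

text \<open>Records one diagonalization of each \<open>A i\<close>, valid for every function
  \<open>f\<close>, so that the values \<open>a i k\<close> and the weights built from
  \<open>W i\<close> do not depend on the order \<open>p\<close>.\<close>

locale posdef_family =
  fixes m :: nat and \<alpha> :: "nat \<Rightarrow> real" and A :: "nat \<Rightarrow> complex^'n^'n"
    and W :: "nat \<Rightarrow> complex^'n^'n" and a :: "nat \<Rightarrow> 'n \<Rightarrow> real"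
  assumes \<alpha>_nonneg: "\<And>i. i \<in> {1..m} \<Longrightarrow> 0 \<le> \<alpha> i" and sum_\<alpha>: "(\<Sum>i=1..m. \<alpha> i) = 1"
    and W: "\<And>i. i \<in> {1..m} \<Longrightarrow> unitary_mat (W i)"
    and a_pos: "\<And>i k. i \<in> {1..m} \<Longrightarrow> 0 < a i k"
    and calculus: "\<And>i f. i \<in> {1..m} \<Longrightarrow> fun_calculus f (A i) = W i ** real_diag (\<lambda>k. f (a i k)) ** cadjoint (W i)"
begin

definition S :: "real \<Rightarrow> complex^'n^'n" where
  "S p = (\<Sum>i=1..m. \<alpha> i *\<^sub>R fun_calculus (mean_gen p) (A i))"

definition weight :: "complex^'n \<Rightarrow> nat \<times> 'n \<Rightarrow> real" where
  "weight x = (\<lambda>(i, k). \<alpha> i * (cmod ((cadjoint (W i) *v x) $ k))\<^sup>2)"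

abbreviation "index \<equiv> {1..m} \<times> (UNIV :: 'n set)"

text \<open>Each \<open>W i\<close> is unitary, so the weights with first index \<open>i\<close> add
  up to \<open>\<alpha> i\<close>.\<close>

lemma weighted_weight:
  assumes "norm x = 1"
  shows "weighted index (weight x)"
proof
  show "finite index" by simp
  show "0 \<le> weight x k" if "k \<in> index" for k
    using that \<alpha>_nonneg by (auto simp: weight_def)
  have "sum (weight x) index = (\<Sum>i=1..m. \<Sum>k\<in>UNIV. \<alpha> i * (cmod ((cadjoint (W i) *v x) $ k))\<^sup>2)"
    by (simp add: weight_def sum.cartesian_product)
  also have "\<dots> = (\<Sum>i=1..m. \<alpha> i)"
    using assms by (intro sum.cong refl) (simp add: sum_unitary_components[OF W] flip: sum_distrib_left)
  finally show "sum (weight x) index = 1" using sum_\<alpha> by simp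
qed

lemma quadratic_form_S: "x \<bullet> (S p *v x) = (\<Sum>(i, k)\<in>index. weight x (i, k) * mean_gen p (a i k))"
proof -
  have "S p *v x = (\<Sum>i=1..m. \<alpha> i *\<^sub>R (fun_calculus (mean_gen p) (A i) *v x))"
    by (simp add: S_def vec_eq_iff matrix_vector_mult_def sum_distrib_right scaleR_sum_right)
      (subst sum.swap, simp)
  then have "x \<bullet> (S p *v x) = (\<Sum>i=1..m. \<alpha> i * (x \<bullet> (fun_calculus (mean_gen p) (A i) *v x)))"
    by (simp add: inner_sum_right)
  also have "\<dots> = (\<Sum>i=1..m. \<Sum>k\<in>UNIV. weight x (i, k) * mean_gen p (a i k))"
    by (intro sum.cong refl) (simp add: calculus quadratic_form_diag weight_def sum_distrib_left mult.assoc)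
  finally show ?thesis by (simp add: sum.cartesian_product)
qed

text \<open>An eigenvalue of \<open>S p\<close> is its quadratic form at a unit eigenvector, a
  weighted mean of the \<open>mean_gen p (a i k)\<close>. For \<open>p \<noteq> 0\<close> it is
  therefore positive and in the range of the generator; for \<open>p = 0\<close> any real
  is.\<close>

lemma S_diagonalization:
  obtains U d where "unitary_mat U" "\<And>k. 0 < d k"
    "S p = U ** real_diag (\<lambda>k. mean_gen p (d k)) ** cadjoint U"
    "power_mean m \<alpha> A p = U ** real_diag d ** cadjoint U"
proof -
  have "hermitian_mat (S p)"
    unfolding S_def by (intro hermitian_sum_scaleR) (simp add: calculus hermitian_conj_real_diag)
  then obtain U s where U: "unitary_mat U" and S: "S p = U ** real_diag s ** cadjoint U"
    using spectral_theorem by blast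
  have s: "p = 0 \<or> 0 < s k" for k
  proof (cases "p = 0")
    case False
    let ?x = "U *v axis k 1"
    have x: "cadjoint U *v ?x = axis k 1"
      using U by (simp add: matrix_vector_mul_assoc unitary_mat_def)
    have "norm ?x = 1" using norm_unitary[OF U, of "axis k 1"] by simp
    then interpret weighted index "weight ?x" by (rule weighted_weight)
    have "0 < (\<Sum>j\<in>index. weight ?x j * (case j of (i, k) \<Rightarrow> mean_gen p (a i k)))"
      using a_pos False by (intro sum_pos) (fastforce simp: mean_gen_def order_less_imp_not_eq2)
    also have "\<dots> = ?x \<bullet> (S p *v ?x)"
      unfolding quadratic_form_S by (intro sum.cong) auto
    also have "\<dots> = (\<Sum>j\<in>UNIV. (cmod (axis k 1 $ j))\<^sup>2 * s j)"
      unfolding S quadratic_form_diag x ..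
    also have "\<dots> = (\<Sum>j\<in>UNIV. if j = k then s j else 0)"
      by (intro sum.cong) (auto simp: axis_def)
    finally show ?thesis by simp
  qed simp
  let ?d = "\<lambda>k. mean_gen_inv p (s k)"
  have "S p = U ** real_diag (\<lambda>k. mean_gen p (?d k)) ** cadjoint U"
    using S s by (simp add: mean_gen_gen_inv)
  moreover have "power_mean m \<alpha> A p = U ** real_diag ?d ** cadjoint U"
    unfolding power_mean_eq S_def[symmetric] by (rule fun_calculus_eqI[OF U S])
  moreover have "0 < ?d k" for k using s by (rule mean_gen_inv_pos)
  ultimately show ?thesis using that[of U ?d] U by blast
qed

text \<open>Keeps a common eigenbasis of \<open>S p\<close> and the power mean: the quadratic form
  is computed from the former, the eigenvalues are read off the latter.\<close>

definition sorted_diagonalization ::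
    "(nat \<Rightarrow> 'n) \<Rightarrow> real \<Rightarrow> complex^'n^'n \<Rightarrow> ('n \<Rightarrow> real) \<Rightarrow> bool" where
  "sorted_diagonalization g p U d \<longleftrightarrow> unitary_mat U \<and> (\<forall>k. 0 < d k)
    \<and> S p = U ** real_diag (\<lambda>k. mean_gen p (d k)) ** cadjoint U
    \<and> power_mean m \<alpha> A p = U ** real_diag d ** cadjoint U
    \<and> (\<forall>i j. i \<le> j \<longrightarrow> j < CARD('n) \<longrightarrow> d (g j) \<le> d (g i))"

lemma sorted_diagonalization_exists:
  assumes g: "bij_betw g {..<CARD('n)} UNIV"
  obtains U d where "sorted_diagonalization g p U d"
proof -
  obtain U d where U: "unitary_mat U" "\<And>k. 0 < d k"
    "S p = U ** real_diag (\<lambda>k. mean_gen p (d k)) ** cadjoint U"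
    "power_mean m \<alpha> A p = U ** real_diag d ** cadjoint U"
    by (rule S_diagonalization[where p = p]) blast
  obtain \<pi> where \<pi>: "bij \<pi>" "\<And>i j. i \<le> j \<Longrightarrow> j < CARD('n) \<Longrightarrow> d (\<pi> (g j)) \<le> d (\<pi> (g i))"
    using decreasing_rearrangement[OF g] by blast
  let ?U = "\<chi> i j. U $ i $ \<pi> j"
  have "sorted_diagonalization g p ?U (\<lambda>k. d (\<pi> k))"
    unfolding sorted_diagonalization_def
    using U \<pi> permute_unitary[OF U(1) \<pi>(1)] permute_diag[OF \<pi>(1), of U d]
      permute_diag[OF \<pi>(1), of U "\<lambda>k. mean_gen p (d k)"] by simp
  then show ?thesis by (rule that)
qed

text \<open>Both sides apply \<open>mean_gen_inv p\<close> to the quadratic form of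
  \<open>S p\<close> at \<open>x\<close>, expanded once in the eigenbasis of \<open>S p\<close> and
  once in those of the \<open>A i\<close>.\<close>

lemma scalar_mean_spectral:
  assumes "S p = U ** real_diag (\<lambda>k. mean_gen p (d k)) ** cadjoint U"
  shows "scalar_mean UNIV (\<lambda>k. (cmod ((cadjoint U *v x) $ k))\<^sup>2) d p
    = scalar_mean index (weight x) (\<lambda>(i, k). a i k) p"
proof -
  have "(\<Sum>k\<in>UNIV. (cmod ((cadjoint U *v x) $ k))\<^sup>2 * mean_gen p (d k)) = x \<bullet> (S p *v x)"
    unfolding assms quadratic_form_diag ..
  also have "\<dots> = (\<Sum>j\<in>index. weight x j * mean_gen p (case j of (i, k) \<Rightarrow> a i k))"
    unfolding quadratic_form_S by (intro sum.cong) auto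
  finally show ?thesis by (simp add: scalar_mean_def)
qed

lemma spectral_comparison:
  fixes g :: "nat \<Rightarrow> 'n"
  assumes g: "bij_betw g {..<CARD('n)} UNIV" and "p \<le> q"
    and Ud: "sorted_diagonalization g p U d" and Ve: "sorted_diagonalization g q V e"
  shows "d k \<le> e k"
proof -
  have U: "unitary_mat U" "\<And>k. 0 < d k" "S p = U ** real_diag (\<lambda>k. mean_gen p (d k)) ** cadjoint U"
    "\<And>i j. i \<le> j \<Longrightarrow> j < CARD('n) \<Longrightarrow> d (g j) \<le> d (g i)"
    and V: "unitary_mat V" "\<And>k. 0 < e k" "S q = V ** real_diag (\<lambda>k. mean_gen q (e k)) ** cadjoint V"
    "\<And>i j. i \<le> j \<Longrightarrow> j < CARD('n) \<Longrightarrow> e (g j) \<le> e (g i)"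
    using Ud Ve by (simp_all add: sorted_diagonalization_def)
  obtain j where j: "j < CARD('n)" "k = g j"
    using g by (auto simp: bij_betw_def)
  obtain x where x: "norm x = 1"
    "\<forall>i. j < i \<and> i < CARD('n) \<longrightarrow> (cadjoint U *v x) $ (g i) = 0" "\<forall>i<j. (cadjoint V *v x) $ (g i) = 0"
    using exists_vector_in_both_spans[OF j(1)] by blast
  have g_ex: "\<exists>i<CARD('n). l = g i" for l using g by (auto simp: bij_betw_def)
  have unit: "weighted UNIV (\<lambda>k. (cmod ((cadjoint M *v x) $ k))\<^sup>2)" if "unitary_mat M" for M
    using that x(1) by unfold_locales (simp_all add: sum_unitary_components)
  \<comment> \<open>The nonzero \<open>U\<close>-coordinates of \<open>x\<close> sit at
    \<open>g i\<close> with \<open>i \<le> j\<close>, where \<open>d\<close> is at least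
    \<open>d k\<close>. Dually, the \<open>V\<close>-coordinates sit at \<open>i \<ge> j\<close>,
    where \<open>e\<close> is at most \<open>e k\<close>.\<close>
  have "d k \<le> scalar_mean UNIV (\<lambda>k. (cmod ((cadjoint U *v x) $ k))\<^sup>2) d p"
  proof (rule weighted.scalar_mean_ge[OF unit[OF U(1)]])
    fix l assume l: "(cmod ((cadjoint U *v x) $ l))\<^sup>2 \<noteq> 0"
    obtain i where i: "i < CARD('n)" "l = g i" using g_ex by blast
    then have "i \<le> j" using l x(2) by (metis norm_zero not_less power_zero_numeral)
    then show "d k \<le> d l" using U(4) i j by simp
  qed (use U in auto)
  also have "\<dots> = scalar_mean index (weight x) (\<lambda>(i, k). a i k) p"
    by (rule scalar_mean_spectral[OF U(3)])
  also have "\<dots> \<le> scalar_mean index (weight x) (\<lambda>(i, k). a i k) q"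
    using a_pos \<open>p \<le> q\<close> by (intro weighted.scalar_mean_mono[OF weighted_weight[OF x(1)]]) auto
  also have "\<dots> = scalar_mean UNIV (\<lambda>k. (cmod ((cadjoint V *v x) $ k))\<^sup>2) e q"
    by (rule scalar_mean_spectral[OF V(3), symmetric])
  also have "\<dots> \<le> e k"
  proof (rule weighted.scalar_mean_le[OF unit[OF V(1)]])
    fix l assume l: "(cmod ((cadjoint V *v x) $ l))\<^sup>2 \<noteq> 0"
    obtain i where i: "i < CARD('n)" "l = g i" using g_ex by blast
    then have "j \<le> i" using l x(3) by (metis norm_zero not_less power_zero_numeral)
    then show "e l \<le> e k" using V(4) i j by simp
  qed (use V in auto)
  finally show ?thesis .
qed

section \<open>Monotonicity of eigenvalues and norms\<close>

lemma enumeration_exists: "\<exists>g :: nat \<Rightarrow> 'n. bij_betw g {..<CARD('n)} UNIV"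
  using ex_bij_betw_nat_finite[of "UNIV :: 'n set"] by (simp add: lessThan_atLeast0)

lemma eigval_power_mean:
  assumes "bij_betw g {..<CARD('n)} UNIV" "sorted_diagonalization g p U d" "i < CARD('n)"
  shows "eigval (Suc i) (power_mean m \<alpha> A p) = d (g i)"
  using assms eigval_sorted_diag[of U g d i] by (simp add: sorted_diagonalization_def)

lemma mono_eigval:
  assumes j: "j \<in> {1..CARD('n)}"
  shows "mono (\<lambda>p. eigval j (power_mean m \<alpha> A p))"
proof (rule monoI)
  fix p q :: real assume "p \<le> q"
  obtain g :: "nat \<Rightarrow> 'n" where g: "bij_betw g {..<CARD('n)} UNIV" using enumeration_exists by blast
  obtain U d where U: "sorted_diagonalization g p U d" by (rule sorted_diagonalization_exists[OF g])
  obtain V e where V: "sorted_diagonalization g q V e" by (rule sorted_diagonalization_exists[OF g])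
  obtain i where "j = Suc i" "i < CARD('n)" using j by (cases j) auto
  then show "eigval j (power_mean m \<alpha> A p) \<le> eigval j (power_mean m \<alpha> A q)"
    using spectral_comparison[OF g \<open>p \<le> q\<close> U V] by (simp add: eigval_power_mean[OF g U] eigval_power_mean[OF g V])
qed

lemma mono_unitarily_invariant_norm:
  assumes N: "unitarily_invariant_norm N"
  shows "mono (\<lambda>p. N (power_mean m \<alpha> A p))"
proof (rule monoI)
  fix p q :: real assume "p \<le> q"
  obtain g :: "nat \<Rightarrow> 'n" where g: "bij_betw g {..<CARD('n)} UNIV" using enumeration_exists by blast
  obtain U d where U: "sorted_diagonalization g p U d" by (rule sorted_diagonalization_exists[OF g])
  obtain V e where V: "sorted_diagonalization g q V e" by (rule sorted_diagonalization_exists[OF g])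
  have "N (real_diag d) \<le> N (real_diag e)"
    using spectral_comparison[OF g \<open>p \<le> q\<close> U V] U
    by (intro unitarily_invariant_norm_diag_mono[OF N]) (auto simp: sorted_diagonalization_def less_imp_le)
  then show "N (power_mean m \<alpha> A p) \<le> N (power_mean m \<alpha> A q)"
    using U V by (simp add: sorted_diagonalization_def unitarily_invariant_norm_conj[OF N])
qed

section \<open>Convergence of the power mean as \<open>p\<close> tends to 0\<close>

definition G :: "real \<Rightarrow> complex^'n^'n" where
  "G p = (\<Sum>i=1..m. \<alpha> i *\<^sub>R (W i ** real_diag (\<lambda>k. (a i k powr p - 1) / p) ** cadjoint (W i)))"

text \<open>The weights \<open>\<alpha> i\<close> sum to 1, so the identity splits off from the sum.
  Thus \<open>G p\<close> is the difference quotient \<open>(S p - 1) / p\<close>, whose limit comes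
  from the derivative of \<open>a powr p\<close> at 0.\<close>

lemma S_eq_affine:
  assumes "p \<noteq> 0"
  shows "S p = mat 1 + p *\<^sub>R G p"
proof -
  have "S p = (\<Sum>i=1..m. \<alpha> i *\<^sub>R (W i ** real_diag (\<lambda>k. 1 + p * ((a i k powr p - 1) / p)) ** cadjoint (W i)))"
    using assms by (simp add: S_def calculus mean_gen_def)
  also have "\<dots> = (\<Sum>i=1..m. \<alpha> i *\<^sub>R (mat 1 + p *\<^sub>R (W i ** real_diag (\<lambda>k. (a i k powr p - 1) / p) ** cadjoint (W i))))"
    by (intro sum.cong refl) (simp only: conj_diag_affine[OF W])
  also have "\<dots> = (\<Sum>i=1..m. \<alpha> i) *\<^sub>R mat 1 + p *\<^sub>R G p"
    by (simp add: G_def scaleR_add_right sum.distrib scaleR_sum_left scaleR_sum_right mult.commute)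
  finally show ?thesis using sum_\<alpha> by simp
qed

lemma tendsto_G: "(G \<longlongrightarrow> S 0) (at 0)"
proof -
  have "S 0 = (\<Sum>i=1..m. \<alpha> i *\<^sub>R (W i ** real_diag (\<lambda>k. ln (a i k)) ** cadjoint (W i)))"
    by (simp add: S_def calculus mean_gen_def)
  moreover have "(G \<longlongrightarrow> \<dots>) (at 0)"
    unfolding G_def[abs_def]
    by (intro tendsto_sum tendsto_scaleR tendsto_const tendsto_matrix_mult tendsto_real_diag tendsto_powr_diff_quotient a_pos)
  ultimately show ?thesis by simp
qed

text \<open>In the basis \<open>U n\<close> the matrix \<open>G (p n)\<close> is diagonal with
  entries \<open>h n\<close>. Once the bases converge along \<open>r\<close>, the limit of
  \<open>G\<close> makes these entries converge too.\<close>

lemma power_mean_subsequence: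
  assumes p: "p \<longlonglongrightarrow> 0" "\<And>n. p n \<noteq> 0"
  shows "\<exists>r. strict_mono (r :: nat \<Rightarrow> nat) \<and> (\<lambda>n. power_mean m \<alpha> A (p (r n))) \<longlonglongrightarrow> power_mean m \<alpha> A 0"
proof -
  have "\<forall>n. \<exists>U d. unitary_mat U \<and> (\<forall>k. 0 < d k) \<and>
      S (p n) = U ** real_diag (\<lambda>k. mean_gen (p n) (d k)) ** cadjoint U \<and>
      power_mean m \<alpha> A (p n) = U ** real_diag d ** cadjoint U"
    by (metis S_diagonalization)
  then obtain U d where U: "\<And>n. unitary_mat (U n)" "\<And>n k. 0 < d n k"
      "\<And>n. S (p n) = U n ** real_diag (\<lambda>k. mean_gen (p n) (d n k)) ** cadjoint (U n)"
      "\<And>n. power_mean m \<alpha> A (p n) = U n ** real_diag (d n) ** cadjoint (U n)"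
    by metis
  obtain V r where V: "unitary_mat V" and r: "strict_mono (r :: nat \<Rightarrow> nat)" and lim: "(\<lambda>n. U (r n)) \<longlonglongrightarrow> V"
    using unitary_convergent_subsequence[of U] U(1) by blast
  have pr: "(\<lambda>n. p (r n)) \<longlonglongrightarrow> 0"
    using LIMSEQ_subseq_LIMSEQ[OF p(1) r] by (simp add: comp_def)
  define h where "h = (\<lambda>n k. (d n k powr p n - 1) / p n)"
  have powr: "d n k powr p n = 1 + p n * h n k" for n k
    using p(2) by (simp add: h_def)
  have G_eq: "G (p n) = U n ** real_diag (h n) ** cadjoint (U n)" for n
  proof -
    have "mat 1 + p n *\<^sub>R G (p n) = U n ** real_diag (\<lambda>k. 1 + p n * h n k) ** cadjoint (U n)"
      using U(3)[of n] p(2) by (simp add: S_eq_affine mean_gen_def powr)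
    also have "\<dots> = mat 1 + p n *\<^sub>R (U n ** real_diag (h n) ** cadjoint (U n))"
      by (rule conj_diag_affine[OF U(1)])
    finally show ?thesis using p(2) by simp
  qed
  have G_lim: "(\<lambda>n. G (p (r n))) \<longlonglongrightarrow> S 0"
    using p(2) by (intro filterlim_compose[OF tendsto_G]) (simp add: filterlim_at pr)
  have "(\<lambda>n. cadjoint (U (r n)) ** G (p (r n)) ** U (r n)) \<longlonglongrightarrow> cadjoint V ** S 0 ** V"
    by (intro tendsto_matrix_mult tendsto_cadjoint lim G_lim)
  then have diag_lim: "(\<lambda>n. real_diag (h (r n))) \<longlonglongrightarrow> cadjoint V ** S 0 ** V"
    by (simp add: G_eq conj_conj_diag U(1))
  \<comment> \<open>Diagonal entries of a limit of real diagonal matrices; uniqueness of limits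
    below identifies them as eigenvalues of \<open>S 0\<close>.\<close>
  define c where "c = (\<lambda>k. Re ((cadjoint V ** S 0 ** V) $ k $ k))"
  have h_lim: "(\<lambda>n. h (r n) k) \<longlonglongrightarrow> c k" for k
    using tendsto_Re[OF tendsto_vec_nth[OF tendsto_vec_nth[OF diag_lim, of k], of k]]
    by (simp add: c_def real_diag_def)
  have "(\<lambda>n. U (r n) ** real_diag (h (r n)) ** cadjoint (U (r n))) \<longlonglongrightarrow> V ** real_diag c ** cadjoint V"
    by (intro tendsto_matrix_mult tendsto_cadjoint lim tendsto_real_diag h_lim)
  then have S0: "S 0 = V ** real_diag c ** cadjoint V"
    using G_lim by (simp add: G_eq LIMSEQ_unique)
  have "(\<lambda>n. d (r n) k) \<longlonglongrightarrow> exp (c k)" for k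
  proof -
    \<comment> \<open>The base is \<open>d (r n) k powr p (r n)\<close>, hence positive, and the
      outer power recovers \<open>d (r n) k\<close>.\<close>
    have "(\<lambda>n. (1 + p (r n) * h (r n) k) powr (1 / p (r n))) \<longlonglongrightarrow> exp (c k)"
      using pr h_lim p(2) U(2) by (intro tendsto_powr_inverse_exp) (auto simp flip: powr simp: less_imp_neq[symmetric])
    moreover have "(1 + p (r n) * h (r n) k) powr (1 / p (r n)) = d (r n) k" for n
      using p(2)[of "r n"] U(2)[of "r n" k] by (simp add: powr_powr flip: powr)
    ultimately show ?thesis by simp
  qed
  then have "(\<lambda>n. power_mean m \<alpha> A (p (r n))) \<longlonglongrightarrow> V ** real_diag (\<lambda>k. exp (c k)) ** cadjoint V"
    unfolding U(4) by (intro tendsto_matrix_mult tendsto_cadjoint lim tendsto_real_diag)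
  also have "V ** real_diag (\<lambda>k. exp (c k)) ** cadjoint V = power_mean m \<alpha> A 0"
    unfolding power_mean_eq S_def[symmetric] fun_calculus_eqI[OF V S0] by (simp add: mean_gen_inv_def)
  finally show ?thesis using r by blast
qed

text \<open>Every sequence of nonzero orders tending to 0 has, within each subsequence, a further
  one along which the means converge to the same limit.\<close>

lemma tendsto_power_mean: "(power_mean m \<alpha> A \<longlongrightarrow> power_mean m \<alpha> A 0) (at 0)"
  unfolding tendsto_at_iff_sequentially comp_def
proof (intro allI impI)
  fix p :: "nat \<Rightarrow> real"
  assume p: "\<forall>i. p i \<in> UNIV - {0}" "p \<longlonglongrightarrow> 0"
  show "(\<lambda>n. power_mean m \<alpha> A (p n)) \<longlonglongrightarrow> power_mean m \<alpha> A 0"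
  proof (rule tendsto_if_subsequences)
    fix r :: "nat \<Rightarrow> nat" assume "strict_mono r"
    then have "(\<lambda>n. p (r n)) \<longlonglongrightarrow> 0"
      using LIMSEQ_subseq_LIMSEQ[OF p(2)] by (simp add: comp_def)
    then show "\<exists>s. strict_mono (s :: nat \<Rightarrow> nat) \<and> (\<lambda>n. power_mean m \<alpha> A (p (r (s n)))) \<longlonglongrightarrow> power_mean m \<alpha> A 0"
      using p(1) by (intro power_mean_subsequence) auto
  qed
qed

end

theorem mainTheorem6:
  fixes A :: "nat \<Rightarrow> complex^'n^'n" and \<alpha> :: "nat \<Rightarrow> real" and m :: nat
  assumes "\<And>i. i \<in> {1..m} \<Longrightarrow> posdef_mat (A i)"
    and "\<And>i. i \<in> {1..m} \<Longrightarrow> 0 \<le> \<alpha> i"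
    and "(\<Sum>i=1..m. \<alpha> i) = 1"
  shows "(power_mean m \<alpha> A \<longlongrightarrow> power_mean m \<alpha> A 0) (at 0)
    \<and> (\<forall>j\<in>{1..CARD('n)}. mono (\<lambda>p. eigval j (power_mean m \<alpha> A p)))
    \<and> ((\<forall>i\<in>{1..m}. \<alpha> i = 1 / real m) \<longrightarrow>
        (\<forall>p. p \<noteq> 0 \<longrightarrow>
          power_mean m \<alpha> A p = mat_powr ((1 / real m) *\<^sub>R (\<Sum>i=1..m. mat_powr (A i) p)) (1 / p))
        \<and> (\<forall>j\<in>{1..CARD('n)}. mono (\<lambda>p. eigval j (power_mean m \<alpha> A p)))
        \<and> (\<forall>N. unitarily_invariant_norm N \<longrightarrow> mono (\<lambda>p. N (power_mean m \<alpha> A p))))"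
proof -
  \<comment> \<open>The diagonalizations are chosen before any order \<open>p\<close> is fixed, as
    the locale requires.\<close>
  have "\<forall>i\<in>{1..m}. \<exists>W a. unitary_mat W \<and> (\<forall>k. 0 < a k) \<and>
      (\<forall>f. fun_calculus f (A i) = W ** real_diag (\<lambda>k. f (a k)) ** cadjoint W)"
    using assms(1) by (metis posdef_diagonalization)
  then obtain W a where "\<forall>i\<in>{1..m}. unitary_mat (W i) \<and> (\<forall>k. 0 < a i k) \<and>
      (\<forall>f. fun_calculus f (A i) = W i ** real_diag (\<lambda>k. f (a i k)) ** cadjoint (W i))"
    by metis
  then interpret posdef_family m \<alpha> A W a
    using assms by unfold_locales auto
  have "power_mean m \<alpha> A p = mat_powr ((1 / real m) *\<^sub>R (\<Sum>i=1..m. mat_powr (A i) p)) (1 / p)"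
    if "\<forall>i\<in>{1..m}. \<alpha> i = 1 / real m" "p \<noteq> 0" for p
  proof -
    have "(\<Sum>i=1..m. \<alpha> i *\<^sub>R mat_powr (A i) p) = (1 / real m) *\<^sub>R (\<Sum>i=1..m. mat_powr (A i) p)"
      using that(1) by (simp add: scaleR_sum_right)
    then show ?thesis using that(2) by (simp add: power_mean_def)
  qed
  then show ?thesis
    using tendsto_power_mean mono_eigval mono_unitarily_invariant_norm by blast
qed

end
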